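(* (a) Let $(M^2,g)$ be a 2-dimensional Riemannian manifold. Any generalized harmonic morphism $\phi:(M^2,g)\to\mathbb{R}^2$ is a harmonic morphism. (b) Let $U\subseteq\mathbb{R}^3$ be open. A map $\phi:U\to\mathbb{C}$ is a generalized harmonic morphism if and only if it is a horizontally weakly conformal map and both $\phi$ and $\phi^2$ are biharmonic.
   Context: All manifolds and maps are smooth; $\mathbb{R}^n$ and $\mathbb{C}\cong\mathbb{R}^2$ carry the Euclidean metric. $\Delta$ is the Laplace–Beltrami operator; a (real- or complex-valued) function $u$ is harmonic if $\Delta u=0$ and biharmonic if $\Delta^2u=0$. In (b), $\phi^2$ is the square of $\phi$ in $\mathbb{C}$. A map $\phi:(M,g)\to(N,h)$ between Riemannian manifolds is a harmonic morphism (respectively a generalized harmonic morphism) if for every harmonic function $f:W\to\mathbb{R}$ on an open set $W\subseteq N$ with $\phi^{-1}(W)$ non-empty, the function $f\circ\phi$ is harmonic (respectively biharmonic) on $\phi^{-1}(W)$. A map $\phi:(M,g)\to(N,h)$ is horizontally weakly conformal if there is a function $\lambda:M\to[0,\infty)$ such that at each $x\in M$ either $d\phi_x=0$, or $d\phi_x$ is surjective and $h(d\phi_x(X),d\phi_x(Y))=\lambda(x)^2g(X,Y)$ for all $X,Y\in(\ker d\phi_x)^{\perp}$. For $\phi:U\subseteq\mathbb{R}^3\to\mathbb{C}$ this is equivalent to $\sum_{i=1}^3(\partial\phi/\partial x_i)^2=0$. *)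

theory Defs
  imports "HOL-Analysis.Analysis"
begin

subsection \<open>Smooth functions on open subsets of Euclidean space\<close>

text \<open>Being of class \<open>C\<^sup>k\<close>, for functions on a finite-dimensional space: a function is of class
  \<open>C\<^sup>k\<^sup>+\<^sup>1\<close> when it is differentiable and all its directional derivatives are of class \<open>C\<^sup>k\<close>.
  Meant for open \<open>S\<close> only.\<close>

primrec Ck_on :: "nat \<Rightarrow> 'a::euclidean_space set \<Rightarrow> ('a \<Rightarrow> 'b::real_normed_vector) \<Rightarrow> bool" where
  "Ck_on 0 S f \<longleftrightarrow> continuous_on S f"
| "Ck_on (Suc k) S f \<longleftrightarrow>
     (\<forall>x\<in>S. f differentiable (at x)) \<and> (\<forall>v. Ck_on k S (\<lambda>x. frechet_derivative f (at x) v))"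

definition smooth_on :: "'a::euclidean_space set \<Rightarrow> ('a \<Rightarrow> 'b::real_normed_vector) \<Rightarrow> bool" where
  "smooth_on S f \<longleftrightarrow> (\<forall>k. Ck_on k S f)"

definition partial_deriv :: "'n \<Rightarrow> (real^'n::finite \<Rightarrow> 'b::real_normed_vector) \<Rightarrow> real^'n \<Rightarrow> 'b" where
  "partial_deriv i f x = frechet_derivative f (at x) (axis i 1)"

subsection \<open>Riemannian manifolds\<close>

text \<open>A chart is its domain together with its coordinate map; the values of the coordinate map
  outside the domain are irrelevant.\<close>

type_synonym ('m, 'n) chart = "'m set \<times> ('m \<Rightarrow> real^'n)"

abbreviation chart_dom :: "('m, 'n::finite) chart \<Rightarrow> 'm set" where
  "chart_dom c \<equiv> fst c"

abbreviation chart_map :: "('m, 'n::finite) chart \<Rightarrow> 'm \<Rightarrow> real^'n" where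
  "chart_map c \<equiv> snd c"

definition chart_inv :: "('m, 'n::finite) chart \<Rightarrow> real^'n \<Rightarrow> 'm" where
  "chart_inv c = inv_into (chart_dom c) (chart_map c)"

text \<open>The points of the manifold are those of \<open>topspace (mtop M)\<close>. The atlas need not be maximal.
  The metric is given by its components: \<open>gram M c x\<close> is the matrix \<open>(g\<^sub>i\<^sub>j)\<close> in the chart \<open>c\<close>
  at the point with coordinates \<open>x\<close>.\<close>

record ('m, 'n) riemannian_data =
  mtop :: "'m topology"
  atlas :: "('m, 'n::finite) chart set"
  gram :: "('m, 'n) chart \<Rightarrow> real^'n \<Rightarrow> real^'n^'n"

definition smooth_structure :: "('m, 'n::finite) riemannian_data \<Rightarrow> bool" where
  "smooth_structure M \<longleftrightarrow>
     Hausdorff_space (mtop M) \<and> second_countable (mtop M) \<and>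
     (\<Union>c\<in>atlas M. chart_dom c) = topspace (mtop M) \<and>
     (\<forall>c\<in>atlas M. openin (mtop M) (chart_dom c) \<and> open (chart_map c ` chart_dom c) \<and>
        homeomorphic_map (subtopology (mtop M) (chart_dom c))
          (top_of_set (chart_map c ` chart_dom c)) (chart_map c)) \<and>
     (\<forall>c\<in>atlas M. \<forall>d\<in>atlas M.
        smooth_on (chart_map c ` (chart_dom c \<inter> chart_dom d)) (chart_map d \<circ> chart_inv c))"

definition riemannian_metric :: "('m, 'n::finite) riemannian_data \<Rightarrow> bool" where
  "riemannian_metric M \<longleftrightarrow>
     (\<forall>c\<in>atlas M. smooth_on (chart_map c ` chart_dom c) (gram M c) \<and>
        (\<forall>x \<in> chart_map c ` chart_dom c.
           transpose (gram M c x) = gram M c x \<and> (\<forall>v. v \<noteq> 0 \<longrightarrow> v \<bullet> (gram M c x *v v) > 0))) \<and>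
     (\<forall>c\<in>atlas M. \<forall>d\<in>atlas M. \<forall>x \<in> chart_map c ` (chart_dom c \<inter> chart_dom d).
        let J = matrix (frechet_derivative (chart_map d \<circ> chart_inv c) (at x))
        in gram M c x = transpose J ** gram M d (chart_map d (chart_inv c x)) ** J)"

text \<open>The dimension is \<open>CARD('n)\<close>.\<close>

definition riemannian_manifold :: "('m, 'n::finite) riemannian_data \<Rightarrow> bool" where
  "riemannian_manifold M \<longleftrightarrow> smooth_structure M \<and> riemannian_metric M"

text \<open>The flat metric on \<open>U\<close> in the single global chart \<open>e\<close>, which is meant to be a linear isometry.\<close>

definition flat_manifold ::
    "'m::topological_space set \<Rightarrow> ('m \<Rightarrow> real^'n::finite) \<Rightarrow> ('m, 'n) riemannian_data" where
  "flat_manifold U e = \<lparr>mtop = top_of_set U, atlas = {(U, e)}, gram = (\<lambda>_ _. mat 1)\<rparr>"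

definition euclidean_domain :: "(real^'n::finite) set \<Rightarrow> (real^'n, 'n) riemannian_data" where
  "euclidean_domain U = flat_manifold U (\<lambda>x. x)"

definition complex_plane :: "(complex, 2) riemannian_data" where
  "complex_plane = flat_manifold UNIV (\<lambda>z. vector [Re z, Im z])"

subsection \<open>Smooth maps and functions, and the Laplace--Beltrami operator\<close>

text \<open>Maps and functions are total on the underlying types; only their values on the manifold, or on
  the open set under consideration, matter.\<close>

definition map_in_charts ::
    "('m, 'k::finite) chart \<Rightarrow> ('n, 'l::finite) chart \<Rightarrow> ('m \<Rightarrow> 'n) \<Rightarrow> real^'k \<Rightarrow> real^'l" where
  "map_in_charts c d \<phi> = chart_map d \<circ> \<phi> \<circ> chart_inv c"

definition smooth_map ::
    "('m, 'k::finite) riemannian_data \<Rightarrow> ('n, 'l::finite) riemannian_data \<Rightarrow> ('m \<Rightarrow> 'n) \<Rightarrow> bool" where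
  "smooth_map M N \<phi> \<longleftrightarrow>
     continuous_map (mtop M) (mtop N) \<phi> \<and>
     (\<forall>c\<in>atlas M. \<forall>d\<in>atlas N.
        smooth_on (chart_map c ` {p \<in> chart_dom c. \<phi> p \<in> chart_dom d}) (map_in_charts c d \<phi>))"

definition smooth_fun_on ::
    "('m, 'k::finite) riemannian_data \<Rightarrow> 'm set \<Rightarrow> ('m \<Rightarrow> 'b::real_normed_vector) \<Rightarrow> bool" where
  "smooth_fun_on M A u \<longleftrightarrow>
     (\<forall>c\<in>atlas M. smooth_on (chart_map c ` (chart_dom c \<inter> A)) (u \<circ> chart_inv c))"

text \<open>\<open>\<Delta>u = |g|\<^sup>-\<^sup>1\<^sup>/\<^sup>2 \<partial>\<^sub>i (|g|\<^sup>1\<^sup>/\<^sup>2 g\<^sup>i\<^sup>j \<partial>\<^sub>j u)\<close>, for real- and for complex-valued \<open>u\<close> at once.\<close>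

definition laplacian_coord ::
    "(real^'n::finite \<Rightarrow> real^'n^'n) \<Rightarrow> (real^'n \<Rightarrow> 'b::real_normed_vector) \<Rightarrow> real^'n \<Rightarrow> 'b" where
  "laplacian_coord G u x =
     (1 / sqrt (det (G x))) *\<^sub>R
       (\<Sum>i\<in>UNIV. partial_deriv i
          (\<lambda>y. \<Sum>j\<in>UNIV. (sqrt (det (G y)) * matrix_inv (G y) $ i $ j) *\<^sub>R partial_deriv j u y) x)"

text \<open>The Laplace--Beltrami operator of \<open>M\<close> on the domain of the chart \<open>c\<close>. As the operator is local and
  its coordinate expression is invariant, \<open>\<Delta>u\<close> and \<open>\<Delta>\<^sup>2u\<close> may be computed on each chart domain
  separately.\<close>

definition laplace_beltrami ::
    "('m, 'n::finite) riemannian_data \<Rightarrow> ('m, 'n) chart \<Rightarrow> ('m \<Rightarrow> 'b::real_normed_vector) \<Rightarrow> 'm \<Rightarrow> 'b" where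
  "laplace_beltrami M c u p = laplacian_coord (gram M c) (u \<circ> chart_inv c) (chart_map c p)"

definition harmonic_on ::
    "('m, 'n::finite) riemannian_data \<Rightarrow> 'm set \<Rightarrow> ('m \<Rightarrow> 'b::real_normed_vector) \<Rightarrow> bool" where
  "harmonic_on M A u \<longleftrightarrow>
     smooth_fun_on M A u \<and>
     (\<forall>c\<in>atlas M. \<forall>p \<in> chart_dom c \<inter> A. laplace_beltrami M c u p = 0)"

definition biharmonic_on ::
    "('m, 'n::finite) riemannian_data \<Rightarrow> 'm set \<Rightarrow> ('m \<Rightarrow> 'b::real_normed_vector) \<Rightarrow> bool" where
  "biharmonic_on M A u \<longleftrightarrow>
     smooth_fun_on M A u \<and>
     (\<forall>c\<in>atlas M. \<forall>p \<in> chart_dom c \<inter> A. laplace_beltrami M c (laplace_beltrami M c u) p = 0)"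

subsection \<open>Harmonic morphisms and horizontally weakly conformal maps\<close>

definition mpreimage ::
    "('m, 'k::finite) riemannian_data \<Rightarrow> ('m \<Rightarrow> 'n) \<Rightarrow> 'n set \<Rightarrow> 'm set" where
  "mpreimage M \<phi> W = {p \<in> topspace (mtop M). \<phi> p \<in> W}"

definition harmonic_morphism ::
    "('m, 'k::finite) riemannian_data \<Rightarrow> ('n, 'l::finite) riemannian_data \<Rightarrow> ('m \<Rightarrow> 'n) \<Rightarrow> bool" where
  "harmonic_morphism M N \<phi> \<longleftrightarrow>
     smooth_map M N \<phi> \<and>
     (\<forall>W (f :: 'n \<Rightarrow> real).
        openin (mtop N) W \<and> mpreimage M \<phi> W \<noteq> {} \<and> harmonic_on N W f \<longrightarrow>
        harmonic_on M (mpreimage M \<phi> W) (f \<circ> \<phi>))"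

definition generalized_harmonic_morphism ::
    "('m, 'k::finite) riemannian_data \<Rightarrow> ('n, 'l::finite) riemannian_data \<Rightarrow> ('m \<Rightarrow> 'n) \<Rightarrow> bool" where
  "generalized_harmonic_morphism M N \<phi> \<longleftrightarrow>
     smooth_map M N \<phi> \<and>
     (\<forall>W (f :: 'n \<Rightarrow> real).
        openin (mtop N) W \<and> mpreimage M \<phi> W \<noteq> {} \<and> harmonic_on N W f \<longrightarrow>
        biharmonic_on M (mpreimage M \<phi> W) (f \<circ> \<phi>))"

text \<open>\<open>d\<phi>\<^sub>p\<close> as a linear map between the coordinate spaces of a chart around \<open>p\<close> and one around \<open>\<phi> p\<close>.\<close>

definition differential_in_charts ::
    "('m, 'k::finite) chart \<Rightarrow> ('n, 'l::finite) chart \<Rightarrow> ('m \<Rightarrow> 'n) \<Rightarrow> 'm \<Rightarrow> real^'k \<Rightarrow> real^'l" where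
  "differential_in_charts c d \<phi> p = frechet_derivative (map_in_charts c d \<phi>) (at (chart_map c p))"

definition metric_at ::
    "('m, 'n::finite) riemannian_data \<Rightarrow> ('m, 'n) chart \<Rightarrow> 'm \<Rightarrow> real^'n \<Rightarrow> real^'n \<Rightarrow> real" where
  "metric_at M c p v w = v \<bullet> (gram M c (chart_map c p) *v w)"

definition horizontally_weakly_conformal ::
    "('m, 'k::finite) riemannian_data \<Rightarrow> ('n, 'l::finite) riemannian_data \<Rightarrow> ('m \<Rightarrow> 'n) \<Rightarrow> bool" where
  "horizontally_weakly_conformal M N \<phi> \<longleftrightarrow>
     smooth_map M N \<phi> \<and>
     (\<exists>dil :: 'm \<Rightarrow> real.
        (\<forall>p \<in> topspace (mtop M). dil p \<ge> 0) \<and>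
        (\<forall>p \<in> topspace (mtop M). \<forall>c\<in>atlas M. \<forall>d\<in>atlas N.
           p \<in> chart_dom c \<and> \<phi> p \<in> chart_dom d \<longrightarrow>
           (let A = differential_in_charts c d \<phi> p;
                H = {X. \<forall>Z. A Z = 0 \<longrightarrow> metric_at M c p X Z = 0}
            in (\<forall>X. A X = 0) \<or>
               (surj A \<and>
                (\<forall>X\<in>H. \<forall>Y\<in>H. metric_at N d (\<phi> p) (A X) (A Y) = (dil p)\<^sup>2 * metric_at M c p X Y)))))"

end

theory Submission
  imports Defs "HOL-Complex_Analysis.Complex_Analysis"
begin

text \<open>
In a chart the Laplace--Beltrami operator has the form \<open>L u = s \<Sum>\<^sub>i \<partial>\<^sub>i (\<Sum>\<^sub>j P\<^sub>i\<^sub>j \<partial>\<^sub>j u)\<close> with \<open>P\<close> symmetric, and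
\<open>L (u v) = u L v + v L u + 2 \<Gamma>(u, v)\<close> for the bilinear form \<open>\<Gamma>(u, v) = s \<Sum>\<^sub>i\<^sub>j P\<^sub>i\<^sub>j \<partial>\<^sub>i u \<partial>\<^sub>j v\<close>. Regard the map as a
complex-valued function \<open>\<psi>\<close>, and put \<open>\<tau> = L \<psi>\<close> (its tension) and \<open>q = \<Gamma>(\<psi>, \<psi>)\<close> (which vanishes exactly when
\<open>\<psi>\<close> is horizontally weakly conformal). For holomorphic \<open>F\<close> the product rule and the chain rule give

\<open>L (F \<circ> \<psi>) = F'(\<psi>) \<tau> + F''(\<psi>) q\<close>,

\<open>L\<^sup>2 (F \<circ> \<psi>) = F'(\<psi>) L \<tau> + F''(\<psi>) (\<tau>\<^sup>2 + 2 \<Gamma>(\<psi>, \<tau>) + L q) + F'''(\<psi>) (2 q \<tau> + 2 \<Gamma>(\<psi>, q)) + F''''(\<psi>) q\<^sup>2\<close>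

(\<open>div_op_holomorphic_comp\<close>, \<open>div_op_div_op_holomorphic_comp\<close>). A harmonic function on a plane open set is
locally the real part of a holomorphic one (\<open>harmonic_locally_Re_holomorphic\<close>), so these two formulas
decide which compositions \<open>f \<circ> \<psi>\<close> are harmonic or biharmonic.

If \<open>\<psi>\<close> is a generalized harmonic morphism, testing with fourth powers gives \<open>q\<^sup>2 = 0\<close>; with \<open>q = 0\<close>
everywhere, the condition becomes \<open>L \<tau> = 0\<close> and \<open>\<tau>\<^sup>2 + 2 \<Gamma>(\<psi>, \<tau>) = 0\<close> (\<open>biharmonic_test_consequences\<close>).
These two equations are also what biharmonicity of \<open>\<psi>\<close> and of \<open>\<psi>\<^sup>2\<close> says when \<open>q = 0\<close>. That is part (b),
together with the linear algebra which identifies \<open>q = 0\<close> with the definition of horizontal weak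
conformality (\<open>weakly_conformal_pair_iff\<close>).

For part (a) it remains to see that \<open>\<tau> = 0\<close> on a surface (\<open>planar_conformal_div_op_eq_0\<close>). In dimension
two \<open>P\<close> has determinant 1, and \<open>q = 0\<close> forces the vector \<open>P \<nabla>\<psi>\<close> to be \<open>\<plusminus>\<i>\<close> times \<open>\<nabla>\<psi>\<close> rotated by a right angle.
The sign is locally constant where \<open>d\<psi> \<noteq> 0\<close>, and a rotated gradient is divergence-free, so \<open>\<tau> = 0\<close> there;
where \<open>d\<psi> = 0\<close> the second equation reads \<open>\<tau>\<^sup>2 = 0\<close>. This replaces isothermal coordinates. With
\<open>\<tau> = q = 0\<close> the first formula shows that \<open>f \<circ> \<psi>\<close> is harmonic for every harmonic \<open>f\<close>.
\<close>

section \<open>Calculus of smooth functions\<close>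

lemma Ck_on_cong:
  assumes "open S" "Ck_on k S f" "\<And>x. x \<in> S \<Longrightarrow> f x = g x"
  shows "Ck_on k S g"
  using assms(2,3)
proof (induction k arbitrary: f g)
  case 0
  then show ?case using continuous_on_cong by force
next
  case (Suc k)
  have D: "(g has_derivative frechet_derivative f (at x)) (at x)" if "x \<in> S" for x
    using Suc.prems that assms(1) has_derivative_transform_within_open frechet_derivative_works
    by (metis Ck_on.simps(2))
  have eq: "frechet_derivative f (at x) v = frechet_derivative g (at x) v" if "x \<in> S" for x v
    using frechet_derivative_at[OF D[OF that]] by simp
  have "Ck_on k S (\<lambda>x. frechet_derivative g (at x) v)" for v
    by (rule Suc.IH[OF _ eq]) (use Suc.prems in auto)
  then show ?case using D by (auto simp: differentiable_def)
qed

text \<open>The workhorse of every smoothness proof below: any pointwise formula \<open>f'\<close> for the derivative may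
  replace the canonical \<open>frechet_derivative\<close>, because on an open set membership in the class only
  depends on the values there.\<close>
lemma Ck_onI:
  assumes "open S" "\<And>x. x \<in> S \<Longrightarrow> (f has_derivative f' x) (at x)"
    and "\<And>v. Ck_on k S (\<lambda>x. f' x v)"
  shows "Ck_on (Suc k) S f"
proof -
  have "f' x v = frechet_derivative f (at x) v" if "x \<in> S" for x v
    using frechet_derivative_at[OF assms(2)[OF that]] by simp
  then show ?thesis
    using Ck_on_cong[OF assms(1,3)] assms(2) differentiableI by fastforce
qed

lemma Ck_on_has_derivative:
  "Ck_on (Suc k) S f \<Longrightarrow> x \<in> S \<Longrightarrow> (f has_derivative frechet_derivative f (at x)) (at x)"
  using frechet_derivative_works by auto

lemma Ck_on_subset: "Ck_on k S f \<Longrightarrow> T \<subseteq> S \<Longrightarrow> Ck_on k T f"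
  by (induction k arbitrary: f) (auto intro: continuous_on_subset)

lemma Ck_on_Suc_imp: "Ck_on (Suc k) S f \<Longrightarrow> Ck_on k S f"
proof (induction k arbitrary: f)
  case 0
  then show ?case
    by (auto intro!: differentiable_imp_continuous_on differentiable_at_imp_differentiable_on)
next
  case (Suc k)
  then show ?case by auto
qed

lemma Ck_on_const: "open S \<Longrightarrow> Ck_on k S (\<lambda>x. c)"
  by (induction k arbitrary: c) auto

lemma Ck_on_bounded_linear:
  assumes "bounded_linear L" "open S" "Ck_on k S f"
  shows "Ck_on k S (\<lambda>x. L (f x))"
  using assms(3)
proof (induction k arbitrary: f)
  case 0
  then show ?case using bounded_linear.continuous_on[OF assms(1)] by auto
next
  case (Suc k)
  show ?case
    by (rule Ck_onI[OF assms(2) bounded_linear.has_derivative[OF assms(1)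
          Ck_on_has_derivative[OF Suc.prems]] Suc.IH]) (use Suc.prems in auto)
qed

lemma Ck_on_add:
  assumes "open S" "Ck_on k S f" "Ck_on k S g"
  shows "Ck_on k S (\<lambda>x. f x + g x)"
  using assms(2,3)
proof (induction k arbitrary: f g)
  case 0
  then show ?case by (auto intro: continuous_intros)
next
  case (Suc k)
  show ?case
    by (rule Ck_onI[OF assms(1) has_derivative_add[OF Ck_on_has_derivative[OF Suc.prems(1)]
          Ck_on_has_derivative[OF Suc.prems(2)]] Suc.IH]) (use Suc.prems in auto)
qed

lemma Ck_on_bounded_bilinear:
  assumes "bounded_bilinear B" "open S" "Ck_on k S f" "Ck_on k S g"
  shows "Ck_on k S (\<lambda>x. B (f x) (g x))"
  using assms(3,4)
proof (induction k arbitrary: f g)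
  case 0
  then show ?case using bounded_bilinear.continuous_on[OF assms(1)] by auto
next
  case (Suc k)
  show ?case
    by (rule Ck_onI[OF assms(2) bounded_bilinear.FDERIV[OF assms(1)
          Ck_on_has_derivative[OF Suc.prems(1)] Ck_on_has_derivative[OF Suc.prems(2)]]
          Ck_on_add[OF assms(2) Suc.IH Suc.IH]])
      (use Suc.prems Ck_on_Suc_imp in auto)
qed

text \<open>The chain rule \<open>d(F \<circ> \<psi>) = (F' \<circ> \<psi>) d\<psi>\<close> reproduces a composition of the same kind, since \<open>F'\<close> is
  again holomorphic; so the induction needs the product rule but no chain rule of higher order.\<close>
lemma Ck_on_holomorphic_comp:
  assumes "open S" "open W" "F holomorphic_on W" "Ck_on k S \<psi>" "\<And>x. x \<in> S \<Longrightarrow> \<psi> x \<in> W"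
  shows "Ck_on k S (\<lambda>x. F (\<psi> x))"
  using assms(3,4)
proof (induction k arbitrary: F)
  case 0
  then show ?case
    using continuous_on_compose2[OF holomorphic_on_imp_continuous_on, of F W S \<psi>] assms(5) by auto
next
  case (Suc k)
  have D: "((\<lambda>x. F (\<psi> x)) has_derivative
      (\<lambda>v. deriv F (\<psi> x) * frechet_derivative \<psi> (at x) v)) (at x)" if "x \<in> S" for x
    using has_derivative_compose[OF Ck_on_has_derivative[OF Suc.prems(2) that]]
      holomorphic_derivI[OF Suc.prems(1) assms(2) assms(5)[OF that]]
    by (auto simp: has_field_derivative_def)
  show ?case
    by (rule Ck_onI[OF assms(1) D Ck_on_bounded_bilinear[OF bounded_bilinear_mult assms(1)]])
      (use Suc.prems Suc.IH[OF holomorphic_deriv[OF Suc.prems(1) assms(2)] Ck_on_Suc_imp] in auto)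
qed

text \<open>The function \<open>r = h\<^sup>-\<^sup>1\<^sup>/\<^sup>2\<close> satisfies \<open>dr = -r\<^sup>3 dh / 2\<close>, whose right-hand side is as smooth as \<open>r\<close> and
  \<open>dh\<close> are; hence each step of the induction gains a derivative.\<close>
lemma Ck_on_inverse_sqrt:
  fixes h :: "'a::euclidean_space \<Rightarrow> real"
  assumes "open S" "Ck_on k S h" "\<And>x. x \<in> S \<Longrightarrow> h x > 0"
  shows "Ck_on k S (\<lambda>x. 1 / sqrt (h x))"
  using assms(2)
proof (induction k)
  case 0
  then show ?case using assms(3) by (auto intro!: continuous_intros) force
next
  case (Suc k)
  let ?r = "\<lambda>x. 1 / sqrt (h x)"
  have D: "(?r has_derivative
      (\<lambda>v. (- 1/2) *\<^sub>R ((?r x * (?r x * ?r x)) * frechet_derivative h (at x) v))) (at x)" if "x \<in> S" for x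
  proof -
    have "((\<lambda>y. 1 / sqrt y) has_real_derivative
       (- 1/2) * (1 / sqrt (h x) * (1 / sqrt (h x) * (1 / sqrt (h x))))) (at (h x))"
      using assms(3)[OF that]
      by (auto intro!: derivative_eq_intros simp: field_simps)
    then show ?thesis
      using has_derivative_compose[OF Ck_on_has_derivative[OF Suc.prems that]]
      by (fastforce simp: has_field_derivative_def algebra_simps)
  qed
  have r: "Ck_on k S ?r" using Suc.IH Suc.prems Ck_on_Suc_imp by blast
  show ?case
    by (rule Ck_onI[OF assms(1) D Ck_on_bounded_linear[OF bounded_linear_scaleR_right assms(1)]],
       assumption, intro Ck_on_bounded_bilinear[OF bounded_bilinear_mult assms(1)] r)
     (use Suc.prems in auto)
qed

lemma Ck_on_local:
  assumes "\<And>x. x \<in> S \<Longrightarrow> \<exists>T. open T \<and> x \<in> T \<and> Ck_on k T f"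
  shows "Ck_on k S f"
  using assms
proof (induction k arbitrary: f)
  case 0
  have "isCont f x" if "x \<in> S" for x
    using 0[OF that] continuous_on_eq_continuous_at by auto
  then show ?case by (simp add: continuous_at_imp_continuous_on)
next
  case (Suc k)
  have "f differentiable (at x)" if "x \<in> S" for x
    using Suc.prems[OF that] by auto
  moreover have "Ck_on k S (\<lambda>x. frechet_derivative f (at x) v)" for v
  proof (rule Suc.IH)
    fix x assume "x \<in> S"
    with Suc.prems obtain T where "open T" "x \<in> T" "Ck_on (Suc k) T f" by blast
    then show "\<exists>T. open T \<and> x \<in> T \<and> Ck_on k T (\<lambda>x. frechet_derivative f (at x) v)" by auto
  qed
  ultimately show ?case by simp
qed

lemma smooth_on_cong:
  "open S \<Longrightarrow> smooth_on S f \<Longrightarrow> (\<And>x. x \<in> S \<Longrightarrow> f x = g x) \<Longrightarrow> smooth_on S g"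
  using Ck_on_cong unfolding smooth_on_def by blast

lemma smooth_on_subset: "smooth_on S f \<Longrightarrow> T \<subseteq> S \<Longrightarrow> smooth_on T f"
  using Ck_on_subset unfolding smooth_on_def by blast

lemma smooth_on_imp_continuous_on: "smooth_on S f \<Longrightarrow> continuous_on S f"
  unfolding smooth_on_def by (metis Ck_on.simps(1))

lemma smooth_on_has_derivative:
  "smooth_on S f \<Longrightarrow> x \<in> S \<Longrightarrow> (f has_derivative frechet_derivative f (at x)) (at x)"
  using Ck_on_has_derivative unfolding smooth_on_def by blast

lemma smooth_onI:
  assumes "open S" "\<And>x. x \<in> S \<Longrightarrow> (f has_derivative f' x) (at x)"
    and "\<And>v. smooth_on S (\<lambda>x. f' x v)"
  shows "smooth_on S f"
  unfolding smooth_on_def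
proof
  fix k
  have "Ck_on (Suc k) S f" 
    by (rule Ck_onI[OF assms(1,2)]) (use assms(3) in \<open>auto simp: smooth_on_def\<close>)
  then show "Ck_on k S f" by (rule Ck_on_Suc_imp)
qed

lemma smooth_on_frechet_derivative:
  "smooth_on S f \<Longrightarrow> smooth_on S (\<lambda>x. frechet_derivative f (at x) v)"
  unfolding smooth_on_def by (metis Ck_on.simps(2))

lemma smooth_on_partial_deriv: "smooth_on S f \<Longrightarrow> smooth_on S (partial_deriv i f)"
  unfolding partial_deriv_def[abs_def] by (rule smooth_on_frechet_derivative)

lemma smooth_on_const: "open S \<Longrightarrow> smooth_on S (\<lambda>x. c)"
  unfolding smooth_on_def using Ck_on_const by blast

lemma smooth_on_bounded_linear_comp:
  "bounded_linear L \<Longrightarrow> open S \<Longrightarrow> smooth_on S f \<Longrightarrow> smooth_on S (\<lambda>x. L (f x))"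
  unfolding smooth_on_def using Ck_on_bounded_linear by blast

lemma smooth_on_bounded_linear: "bounded_linear L \<Longrightarrow> open S \<Longrightarrow> smooth_on S L"
  by (rule smooth_onI[where f' = "\<lambda>x. L"])
    (auto intro: bounded_linear_imp_has_derivative smooth_on_const)

lemma smooth_on_add:
  "open S \<Longrightarrow> smooth_on S f \<Longrightarrow> smooth_on S g \<Longrightarrow> smooth_on S (\<lambda>x. f x + g x)"
  unfolding smooth_on_def using Ck_on_add by blast

lemma smooth_on_minus: "open S \<Longrightarrow> smooth_on S f \<Longrightarrow> smooth_on S (\<lambda>x. - f x)"
  by (rule smooth_on_bounded_linear_comp[OF bounded_linear_minus[OF bounded_linear_ident]])

lemma smooth_on_diff:
  assumes "open S" "smooth_on S f" "smooth_on S g"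
  shows "smooth_on S (\<lambda>x. f x - g x)"
  using smooth_on_add[OF assms(1,2) smooth_on_minus[OF assms(1,3)]] by simp

lemma smooth_on_bounded_bilinear:
  "bounded_bilinear B \<Longrightarrow> open S \<Longrightarrow> smooth_on S f \<Longrightarrow> smooth_on S g \<Longrightarrow>
    smooth_on S (\<lambda>x. B (f x) (g x))"
  unfolding smooth_on_def using Ck_on_bounded_bilinear by blast

lemmas smooth_on_mult = smooth_on_bounded_bilinear[OF bounded_bilinear_mult]
lemmas smooth_on_scaleR = smooth_on_bounded_bilinear[OF bounded_bilinear_scaleR]

lemma smooth_on_sum:
  assumes "open S" "\<And>i. i \<in> I \<Longrightarrow> smooth_on S (f i)"
  shows "smooth_on S (\<lambda>x. \<Sum>i\<in>I. f i x)"
  using assms(2)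
  by (induction I rule: infinite_finite_induct) (auto intro: smooth_on_const smooth_on_add assms(1))

lemma smooth_on_holomorphic_comp:
  assumes "open S" "open W" "F holomorphic_on W" "smooth_on S \<psi>" "\<And>x. x \<in> S \<Longrightarrow> \<psi> x \<in> W"
  shows "smooth_on S (\<lambda>x. F (\<psi> x))"
  using Ck_on_holomorphic_comp[OF assms(1-3)] assms(4,5) unfolding smooth_on_def by blast

lemma smooth_on_inverse_sqrt:
  fixes h :: "'a::euclidean_space \<Rightarrow> real"
  shows "open S \<Longrightarrow> smooth_on S h \<Longrightarrow> (\<And>x. x \<in> S \<Longrightarrow> h x > 0) \<Longrightarrow> smooth_on S (\<lambda>x. 1 / sqrt (h x))"
  unfolding smooth_on_def using Ck_on_inverse_sqrt by blast

lemma smooth_on_local: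
  assumes "\<And>x. x \<in> S \<Longrightarrow> \<exists>T. open T \<and> x \<in> T \<and> smooth_on T f"
  shows "smooth_on S f"
  unfolding smooth_on_def
proof (intro allI Ck_on_local)
  fix k x assume "x \<in> S"
  with assms show "\<exists>T. open T \<and> x \<in> T \<and> Ck_on k T f" unfolding smooth_on_def by blast
qed

section \<open>Symmetry of second derivatives\<close>

text \<open>The mean value theorem, used first along \<open>u\<close> and then along \<open>v\<close>, turns the second difference over a
  small parallelogram into a mixed second derivative at one of its points. The left-hand side is
  symmetric in \<open>u\<close> and \<open>v\<close>, which is what makes mixed derivatives commute.\<close>
lemma second_difference_mean_value:
  fixes f :: "'a::euclidean_space \<Rightarrow> real"
  assumes "h > 0" and "\<And>s t. \<lbrakk>0 \<le> s; s \<le> h; 0 \<le> t; t \<le> h\<rbrakk> \<Longrightarrow> x + s *\<^sub>R u + t *\<^sub>R v \<in> S"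
    and "smooth_on S f"
  obtains s t where "0 \<le> s" "s \<le> h" "0 \<le> t" "t \<le> h"
    "f (x + h *\<^sub>R u + h *\<^sub>R v) - f (x + h *\<^sub>R u) - f (x + h *\<^sub>R v) + f x
      = h\<^sup>2 * frechet_derivative (\<lambda>y. frechet_derivative f (at y) u) (at (x + s *\<^sub>R u + t *\<^sub>R v)) v"
proof -
  let ?fu = "\<lambda>y. frechet_derivative f (at y) u"
  let ?p = "\<lambda>s t. x + s *\<^sub>R u + t *\<^sub>R v"
  have along: "((\<lambda>s. g (a + s *\<^sub>R w)) has_real_derivative frechet_derivative g (at (a + s *\<^sub>R w)) w) (at s)"
    if "smooth_on S g" "a + s *\<^sub>R w \<in> S" for g :: "'a \<Rightarrow> real" and a s w
  proof -
    have "((\<lambda>s. g (a + s *\<^sub>R w)) has_derivative (\<lambda>r. frechet_derivative g (at (a + s *\<^sub>R w)) (r *\<^sub>R w))) (at s)"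
      by (rule has_derivative_compose[where f = "\<lambda>s. a + s *\<^sub>R w"])
        (auto intro!: derivative_eq_intros smooth_on_has_derivative[OF that])
    then show ?thesis
      using linear_cmul[OF has_derivative_linear[OF smooth_on_has_derivative[OF that]]]
      unfolding has_field_derivative_def
      by (rule_tac has_derivative_eq_rhs) (auto simp: fun_eq_iff)
  qed
  have "\<exists>s>0. s < h \<and> (f (?p h h) - f (?p h 0)) - (f (?p 0 h) - f (?p 0 0))
      = (h - 0) * (?fu (?p s h) - ?fu (?p s 0))"
  proof (rule MVT2)
    fix s assume s: "0 \<le> s" "s \<le> h"
    have "((\<lambda>s. f ((x + t *\<^sub>R v) + s *\<^sub>R u)) has_real_derivative ?fu ((x + t *\<^sub>R v) + s *\<^sub>R u)) (at s)"
      if "0 \<le> t" "t \<le> h" for t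
      by (rule along[OF assms(3)]) (use assms(2)[OF s that] in \<open>simp add: algebra_simps\<close>)
    from DERIV_diff[OF this this, of h 0]
    show "((\<lambda>s. f (?p s h) - f (?p s 0)) has_real_derivative ?fu (?p s h) - ?fu (?p s 0)) (at s)"
      using \<open>h > 0\<close> by (simp add: algebra_simps)
  qed (use \<open>h > 0\<close> in auto)
  then obtain s where s: "0 < s" "s < h"
    "(f (?p h h) - f (?p h 0)) - (f (?p 0 h) - f (?p 0 0)) = h * (?fu (?p s h) - ?fu (?p s 0))"
    by auto
  have "\<exists>t>0. t < h \<and> ?fu (?p s h) - ?fu (?p s 0) = (h - 0) * frechet_derivative ?fu (at (?p s t)) v"
    by (rule MVT2)
      (use \<open>h > 0\<close> s in \<open>auto intro!: along smooth_on_frechet_derivative assms(2,3)\<close>)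
  then obtain t where t: "0 < t" "t < h"
    "?fu (?p s h) - ?fu (?p s 0) = h * frechet_derivative ?fu (at (?p s t)) v" by auto
  show thesis
    by (rule that[of s t]) (use s t in \<open>auto simp: power2_eq_square\<close>)
qed

lemma frechet_derivative_commute_real:
  fixes f :: "'a::euclidean_space \<Rightarrow> real"
  assumes "open S" "smooth_on S f" "x \<in> S"
  shows "frechet_derivative (\<lambda>y. frechet_derivative f (at y) u) (at x) v
       = frechet_derivative (\<lambda>y. frechet_derivative f (at y) v) (at x) u"
proof (rule ccontr)
  let ?D = "\<lambda>u v y. frechet_derivative (\<lambda>y. frechet_derivative f (at y) u) (at y) v"
  assume "?D u v x \<noteq> ?D v u x"
  define e where "e = \<bar>?D u v x - ?D v u x\<bar> / 2"
  have e: "e > 0" using \<open>?D u v x \<noteq> ?D v u x\<close> by (simp add: e_def)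
  have near: "\<exists>d>0. \<forall>y. dist y x < d \<longrightarrow> y \<in> S \<and> \<bar>?D u v y - ?D u v x\<bar> < e" for u v
  proof -
    have "continuous_on S (?D u v)"
      by (intro smooth_on_imp_continuous_on smooth_on_frechet_derivative assms)
    then have "isCont (?D u v) x" using assms continuous_on_eq_continuous_at by blast
    then obtain d where "d > 0" "\<forall>y. dist y x < d \<longrightarrow> \<bar>?D u v y - ?D u v x\<bar> < e"
      using e unfolding continuous_at_eps_delta dist_real_def by meson
    moreover obtain d' where "d' > 0" "\<forall>y. dist y x < d' \<longrightarrow> y \<in> S"
      using assms by (meson open_dist)
    ultimately show ?thesis by (intro exI[of _ "min d d'"]) auto
  qed
  obtain d1 d2 where d1: "d1 > 0" "\<And>y. dist y x < d1 \<Longrightarrow> y \<in> S \<and> \<bar>?D u v y - ?D u v x\<bar> < e"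
    and d2: "d2 > 0" "\<And>y. dist y x < d2 \<Longrightarrow> y \<in> S \<and> \<bar>?D v u y - ?D v u x\<bar> < e"
    using near[of u v] near[of v u] by blast
  \<comment> \<open>Small enough for the parallelogram spanned by \<open>h u\<close> and \<open>h v\<close> at \<open>x\<close> to lie in both balls; the summand 1 covers \<open>u = v = 0\<close>.\<close>
  define h where "h = min d1 d2 / (2 * (norm u + norm v + 1))"
  have h: "h > 0" using d1 d2 by (auto simp: h_def add_nonneg_pos)
  have small: "dist (x + s *\<^sub>R a + t *\<^sub>R b) x < min d1 d2"
    if "0 \<le> s" "s \<le> h" "0 \<le> t" "t \<le> h" "norm a + norm b = norm u + norm v" for s t a b
  proof -
    have "dist (x + s *\<^sub>R a + t *\<^sub>R b) x = norm (s *\<^sub>R a + t *\<^sub>R b)"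
      by (simp add: dist_norm algebra_simps)
    also have "\<dots> \<le> s * norm a + t * norm b"
      using norm_triangle_ineq[of "s *\<^sub>R a" "t *\<^sub>R b"] that by simp
    also have "\<dots> \<le> h * norm a + h * norm b"
      using that by (intro add_mono mult_right_mono) auto
    also have "\<dots> = h * (norm u + norm v)" using that(5) by (metis distrib_left)
    also have "\<dots> < h * (2 * (norm u + norm v + 1))"
      using h norm_ge_zero[of u] norm_ge_zero[of v] by (intro mult_strict_left_mono) argo+
    also have "\<dots> = min d1 d2" 
    proof -
      have "2 * (norm u + norm v + 1) \<noteq> 0"
        using norm_ge_zero[of u] norm_ge_zero[of v] by argo
      then show ?thesis by (simp add: h_def)
    qed
    finally show ?thesis .
  qed
  obtain s t where st: "0 \<le> s" "s \<le> h" "0 \<le> t" "t \<le> h"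
    "f (x + h *\<^sub>R u + h *\<^sub>R v) - f (x + h *\<^sub>R u) - f (x + h *\<^sub>R v) + f x = h\<^sup>2 * ?D u v (x + s *\<^sub>R u + t *\<^sub>R v)"
    using second_difference_mean_value[OF h _ assms(2), of x u v] small d1(2) by (smt (verit))
  obtain s' t' where st': "0 \<le> s'" "s' \<le> h" "0 \<le> t'" "t' \<le> h"
    "f (x + h *\<^sub>R v + h *\<^sub>R u) - f (x + h *\<^sub>R v) - f (x + h *\<^sub>R u) + f x = h\<^sup>2 * ?D v u (x + s' *\<^sub>R v + t' *\<^sub>R u)"
    using second_difference_mean_value[OF h _ assms(2), of x v u] small d1(2) by (smt (verit))
  have "h\<^sup>2 * ?D u v (x + s *\<^sub>R u + t *\<^sub>R v) = h\<^sup>2 * ?D v u (x + s' *\<^sub>R v + t' *\<^sub>R u)"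
    using st(5) st'(5) by (simp add: algebra_simps)
  then have "?D u v (x + s *\<^sub>R u + t *\<^sub>R v) = ?D v u (x + s' *\<^sub>R v + t' *\<^sub>R u)"
    using h by simp
  moreover have "\<bar>?D u v (x + s *\<^sub>R u + t *\<^sub>R v) - ?D u v x\<bar> < e"
    using d1(2) small[OF st(1-4)] by simp
  moreover have "\<bar>?D v u (x + s' *\<^sub>R v + t' *\<^sub>R u) - ?D v u x\<bar> < e"
    using d2(2) small[OF st'(1-4)] by simp
  moreover have False if "\<bar>a - p\<bar> < \<bar>p - q\<bar> / 2" "\<bar>a - q\<bar> < \<bar>p - q\<bar> / 2" for a p q :: real
    using that by (auto simp: abs_if split: if_splits)
  ultimately show False unfolding e_def by metis
qed

lemma frechet_derivative_commute:
  fixes f :: "'a::euclidean_space \<Rightarrow> complex"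
  assumes "open S" "smooth_on S f" "x \<in> S"
  shows "frechet_derivative (\<lambda>y. frechet_derivative f (at y) u) (at x) v
       = frechet_derivative (\<lambda>y. frechet_derivative f (at y) v) (at x) u"
proof -
  have cong: "frechet_derivative g (at x) w = frechet_derivative h (at x) w"
    if "smooth_on S g" "\<And>y. y \<in> S \<Longrightarrow> g y = h y" for g h :: "'a \<Rightarrow> real" and w
    by (metis assms(1,3) frechet_derivative_at has_derivative_transform_within_open
        smooth_on_has_derivative that)
  have part: "L (frechet_derivative g (at y) w) = frechet_derivative (\<lambda>y. L (g y)) (at y) w"
    if "bounded_linear L" "smooth_on S g" "y \<in> S"
    for L :: "complex \<Rightarrow> real" and g :: "'a \<Rightarrow> complex" and y w
    using frechet_derivative_at[OF bounded_linear.has_derivative[OF that(1)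
        smooth_on_has_derivative[OF that(2,3)]]] by metis
  have real: "L (frechet_derivative (\<lambda>y. frechet_derivative f (at y) u) (at x) v)
       = L (frechet_derivative (\<lambda>y. frechet_derivative f (at y) v) (at x) u)"
    if L: "bounded_linear L" for L :: "complex \<Rightarrow> real"
  proof -
    have "L (frechet_derivative (\<lambda>y. frechet_derivative f (at y) u) (at x) v)
        = frechet_derivative (\<lambda>y. frechet_derivative (\<lambda>y. L (f y)) (at y) u) (at x) v" for u v
      using part[OF L smooth_on_frechet_derivative[OF assms(2)] assms(3)]
        cong[OF smooth_on_bounded_linear_comp[OF L assms(1) smooth_on_frechet_derivative[OF assms(2)]]]
        part[OF L assms(2)] by simp
    then show ?thesis
      using frechet_derivative_commute_real[OF assms(1)
          smooth_on_bounded_linear_comp[OF L assms(1,2)] assms(3)] by simp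
  qed
  show ?thesis
    by (rule complex_eqI) (use real[OF bounded_linear_Re] real[OF bounded_linear_Im] in auto)
qed

lemma partial_deriv_commute:
  fixes f :: "real^'n::finite \<Rightarrow> complex"
  assumes "open S" "smooth_on S f" "x \<in> S"
  shows "partial_deriv i (partial_deriv j f) x = partial_deriv j (partial_deriv i f) x"
  using frechet_derivative_commute[OF assms] unfolding partial_deriv_def[abs_def] by blast

section \<open>Second-order operators in divergence form\<close>

lemma partial_deriv_eq:
  "(f has_derivative f') (at x) \<Longrightarrow> partial_deriv i f x = f' (axis i 1)"
  unfolding partial_deriv_def by (simp add: frechet_derivative_at[symmetric])

lemma partial_deriv_cong:
  assumes "open S" "x \<in> S" "\<And>y. y \<in> S \<Longrightarrow> f y = g y"
  shows "partial_deriv i f x = partial_deriv i g x"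
proof -
  have "(f has_derivative D) (at x) \<longleftrightarrow> (g has_derivative D) (at x)" for D
    using has_derivative_transform_within_open[OF _ assms(1,2)] assms(3) by metis
  then show ?thesis unfolding partial_deriv_def frechet_derivative_def by simp
qed

lemma partial_deriv_add:
  "smooth_on S f \<Longrightarrow> smooth_on S g \<Longrightarrow> x \<in> S \<Longrightarrow>
    partial_deriv i (\<lambda>x. f x + g x) x = partial_deriv i f x + partial_deriv i g x"
  by (subst partial_deriv_eq[OF has_derivative_add[OF smooth_on_has_derivative smooth_on_has_derivative]])
    (auto simp: partial_deriv_def)

lemma partial_deriv_mult:
  fixes f g :: "real^'n::finite \<Rightarrow> complex"
  shows "smooth_on S f \<Longrightarrow> smooth_on S g \<Longrightarrow> x \<in> S \<Longrightarrow>
    partial_deriv i (\<lambda>x. f x * g x) x = f x * partial_deriv i g x + partial_deriv i f x * g x"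
  by (subst partial_deriv_eq[OF has_derivative_mult[OF smooth_on_has_derivative smooth_on_has_derivative]])
    (auto simp: partial_deriv_def)

lemma partial_deriv_bounded_linear:
  "bounded_linear L \<Longrightarrow> smooth_on S f \<Longrightarrow> x \<in> S \<Longrightarrow>
    partial_deriv i (\<lambda>x. L (f x)) x = L (partial_deriv i f x)"
  by (subst partial_deriv_eq[OF bounded_linear.has_derivative[OF _ smooth_on_has_derivative]])
    (auto simp: partial_deriv_def)

lemma partial_deriv_holomorphic_comp:
  assumes "open W" "F holomorphic_on W" "smooth_on S \<psi>" "x \<in> S" "\<psi> x \<in> W"
  shows "partial_deriv i (\<lambda>x. F (\<psi> x)) x = deriv F (\<psi> x) * partial_deriv i \<psi> x"
proof -
  have "(F has_derivative (*) (deriv F (\<psi> x))) (at (\<psi> x))"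
    using holomorphic_derivI[OF assms(2,1,5)] by (simp add: has_field_derivative_def)
  from partial_deriv_eq[OF has_derivative_compose[OF smooth_on_has_derivative[OF assms(3,4)] this]]
  show ?thesis by (simp add: partial_deriv_def)
qed

text \<open>The first-order part of an operator in divergence form: for \<open>P = |g|\<^sup>1\<^sup>/\<^sup>2 g\<^sup>-\<^sup>1\<close> this is the gradient of \<open>u\<close>
  multiplied by the volume density.\<close>
definition flux :: "('n \<Rightarrow> 'n \<Rightarrow> real^'n \<Rightarrow> real) \<Rightarrow> 'n \<Rightarrow> (real^'n::finite \<Rightarrow> 'b::real_normed_vector)
    \<Rightarrow> real^'n \<Rightarrow> 'b" where
  "flux P i u y = (\<Sum>j\<in>UNIV. P i j y *\<^sub>R partial_deriv j u y)"

definition div_op :: "(real^'n \<Rightarrow> real) \<Rightarrow> ('n \<Rightarrow> 'n \<Rightarrow> real^'n \<Rightarrow> real) \<Rightarrow>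
    (real^'n::finite \<Rightarrow> 'b::real_normed_vector) \<Rightarrow> real^'n \<Rightarrow> 'b" where
  "div_op s P u x = s x *\<^sub>R (\<Sum>i\<in>UNIV. partial_deriv i (flux P i u) x)"

text \<open>For \<open>s = |g|\<^sup>-\<^sup>1\<^sup>/\<^sup>2\<close> and \<open>P = |g|\<^sup>1\<^sup>/\<^sup>2 g\<^sup>-\<^sup>1\<close> this is the inner product of the gradients of \<open>u\<close> and \<open>v\<close>,
  extended complex-bilinearly. Below it is written \<open>\<Gamma>(u, v)\<close>, and \<open>div_op s P u\<close> is written \<open>L u\<close>.\<close>
definition grad_prod :: "(real^'n \<Rightarrow> real) \<Rightarrow> ('n \<Rightarrow> 'n \<Rightarrow> real^'n \<Rightarrow> real) \<Rightarrow>
    (real^'n::finite \<Rightarrow> complex) \<Rightarrow> (real^'n \<Rightarrow> complex) \<Rightarrow> real^'n \<Rightarrow> complex" where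
  "grad_prod s P u v x = s x *\<^sub>R (\<Sum>i\<in>UNIV. partial_deriv i u x * flux P i v x)"

lemma flux_cong:
  "open T \<Longrightarrow> x \<in> T \<Longrightarrow> (\<And>y. y \<in> T \<Longrightarrow> u y = v y) \<Longrightarrow> flux P i u x = flux P i v x"
  unfolding flux_def using partial_deriv_cong[of T x u v] by simp

lemma div_op_cong:
  assumes "open T" "x \<in> T" "\<And>y. y \<in> T \<Longrightarrow> u y = v y"
  shows "div_op s P u x = div_op s P v x"
  unfolding div_op_def
  using partial_deriv_cong[OF assms(1,2) flux_cong[OF assms(1) _ assms(3)]] by simp

lemma grad_prod_cong:
  assumes "open T" "x \<in> T" "\<And>y. y \<in> T \<Longrightarrow> u y = u' y" "\<And>y. y \<in> T \<Longrightarrow> v y = v' y"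
  shows "grad_prod s P u v x = grad_prod s P u' v' x"
  unfolding grad_prod_def
  using flux_cong[OF assms(1,2,4)] partial_deriv_cong[OF assms(1,2,3)] by simp

locale divergence_form =
  fixes S :: "(real^'n::finite) set" and s :: "real^'n \<Rightarrow> real"
    and P :: "'n \<Rightarrow> 'n \<Rightarrow> real^'n \<Rightarrow> real"
  assumes open_S: "open S" and smooth_s: "smooth_on S s"
    and smooth_P: "\<And>i j. smooth_on S (P i j)"
    and P_sym: "\<And>x i j. x \<in> S \<Longrightarrow> P i j x = P j i x"
begin

lemma restrict: "open T \<Longrightarrow> T \<subseteq> S \<Longrightarrow> divergence_form T s P"
  using smooth_on_subset[OF smooth_s] smooth_on_subset[OF smooth_P] P_sym
  by unfold_locales blast+

lemma smooth_flux: "smooth_on S u \<Longrightarrow> smooth_on S (flux P i u)"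
  unfolding flux_def[abs_def]
  by (intro smooth_on_sum smooth_on_scaleR smooth_on_partial_deriv smooth_P open_S)

lemma smooth_div_op: "smooth_on S u \<Longrightarrow> smooth_on S (div_op s P u)"
  unfolding div_op_def[abs_def]
  by (intro smooth_on_sum smooth_on_scaleR smooth_on_partial_deriv smooth_flux smooth_s open_S)

lemma smooth_grad_prod: "smooth_on S u \<Longrightarrow> smooth_on S v \<Longrightarrow> smooth_on S (grad_prod s P u v)"
  unfolding grad_prod_def[abs_def]
  by (intro smooth_on_sum smooth_on_scaleR smooth_on_mult smooth_on_partial_deriv smooth_flux
      smooth_s open_S)

lemma grad_prod_sym: "x \<in> S \<Longrightarrow> grad_prod s P u v x = grad_prod s P v u x"
  unfolding grad_prod_def flux_def sum_distrib_left
  by (subst sum.swap) (simp add: P_sym[of x] mult.commute)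

lemma div_op_add:
  assumes "smooth_on S u" "smooth_on S v" "x \<in> S"
  shows "div_op s P (\<lambda>x. u x + v x) x = div_op s P u x + div_op s P v x"
proof -
  have "flux P i (\<lambda>x. u x + v x) y = flux P i u y + flux P i v y" if "y \<in> S" for i y
    unfolding flux_def using partial_deriv_add[OF assms(1,2) that]
    by (simp add: scaleR_right_distrib sum.distrib)
  then have "partial_deriv i (flux P i (\<lambda>x. u x + v x)) x
      = partial_deriv i (flux P i u) x + partial_deriv i (flux P i v) x" for i
    by (subst partial_deriv_add[OF smooth_flux[OF assms(1)] smooth_flux[OF assms(2)] assms(3), symmetric])
      (rule partial_deriv_cong[OF open_S assms(3)])
  then show ?thesis
    unfolding div_op_def by (simp add: scaleR_right_distrib sum.distrib)
qed

lemma div_op_bounded_linear: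
  assumes "bounded_linear L" "smooth_on S u" "x \<in> S"
  shows "div_op s P (\<lambda>x. L (u x)) x = L (div_op s P u x)"
proof -
  interpret L: bounded_linear L by fact
  have "flux P i (\<lambda>x. L (u x)) y = L (flux P i u y)" if "y \<in> S" for i y
    unfolding flux_def using partial_deriv_bounded_linear[OF assms(1,2) that]
    by (simp add: L.sum L.scaleR)
  then have "partial_deriv i (flux P i (\<lambda>x. L (u x))) x = L (partial_deriv i (flux P i u) x)" for i
    by (subst partial_deriv_bounded_linear[OF assms(1) smooth_flux[OF assms(2)] assms(3), symmetric])
      (rule partial_deriv_cong[OF open_S assms(3)])
  then show ?thesis
    unfolding div_op_def by (simp add: L.sum L.scaleR)
qed

text \<open>The identity that characterises second-order operators without zeroth-order term; the symmetry of
  \<open>P\<close> lets the two cross terms be combined.\<close>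
lemma div_op_mult:
  fixes u v :: "real^'n \<Rightarrow> complex"
  assumes "smooth_on S u" "smooth_on S v" "x \<in> S"
  shows "div_op s P (\<lambda>x. u x * v x) x
    = u x * div_op s P v x + v x * div_op s P u x + 2 * grad_prod s P u v x"
proof -
  have flux: "flux P i (\<lambda>x. u x * v x) y = u y * flux P i v y + v y * flux P i u y"
    if "y \<in> S" for i y
    unfolding flux_def using partial_deriv_mult[OF assms(1,2) that]
    by (simp add: scaleR_right_distrib sum.distrib sum_distrib_left algebra_simps)
  have "partial_deriv i (flux P i (\<lambda>x. u x * v x)) x
      = partial_deriv i (\<lambda>y. u y * flux P i v y + v y * flux P i u y) x" for i
    by (rule partial_deriv_cong[OF open_S assms(3) flux])
  also have "\<dots> i = (u x * partial_deriv i (flux P i v) x + v x * partial_deriv i (flux P i u) x)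
      + (partial_deriv i u x * flux P i v x + partial_deriv i v x * flux P i u x)" for i
    using assms smooth_flux[OF assms(1)] smooth_flux[OF assms(2)] open_S
    by (simp add: partial_deriv_add[where S = S] partial_deriv_mult[where S = S] smooth_on_mult)
  finally have "div_op s P (\<lambda>x. u x * v x) x
    = u x * div_op s P v x + v x * div_op s P u x + (grad_prod s P u v x + grad_prod s P v u x)"
    unfolding div_op_def grad_prod_def
    by (simp add: sum.distrib sum_distrib_left scaleR_right_distrib)
  then show ?thesis using grad_prod_sym[OF assms(3), of u v] by simp
qed

lemma grad_prod_holomorphic_comp:
  assumes "open W" "F holomorphic_on W" "smooth_on S \<psi>" "x \<in> S" "\<psi> x \<in> W"
  shows "grad_prod s P (\<lambda>x. F (\<psi> x)) v x = deriv F (\<psi> x) * grad_prod s P \<psi> v x"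
  unfolding grad_prod_def partial_deriv_holomorphic_comp[OF assms]
  by (simp add: sum_distrib_left mult.assoc)

lemma div_op_holomorphic_comp:
  assumes "open W" "F holomorphic_on W" "smooth_on S \<psi>" "\<psi> ` S \<subseteq> W" "x \<in> S"
  shows "div_op s P (\<lambda>x. F (\<psi> x)) x
    = deriv F (\<psi> x) * div_op s P \<psi> x + deriv (deriv F) (\<psi> x) * grad_prod s P \<psi> \<psi> x"
proof -
  have in_W: "\<psi> y \<in> W" if "y \<in> S" for y using that assms(4) by blast
  have F': "deriv F holomorphic_on W" using assms(1,2) by (simp add: holomorphic_deriv)
  have smooth_F': "smooth_on S (\<lambda>x. deriv F (\<psi> x))"
    using smooth_on_holomorphic_comp[OF open_S assms(1) F' assms(3)] in_W by blast
  have flux: "flux P i (\<lambda>x. F (\<psi> x)) y = deriv F (\<psi> y) * flux P i \<psi> y" if "y \<in> S" for i y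
    unfolding flux_def partial_deriv_holomorphic_comp[OF assms(1-3) that in_W[OF that]]
    by (simp add: sum_distrib_left)
  have "partial_deriv i (flux P i (\<lambda>x. F (\<psi> x))) x
      = partial_deriv i (\<lambda>y. deriv F (\<psi> y) * flux P i \<psi> y) x" for i
    by (rule partial_deriv_cong[OF open_S assms(5) flux])
  also have "\<dots> i = deriv F (\<psi> x) * partial_deriv i (flux P i \<psi>) x
      + deriv (deriv F) (\<psi> x) * (partial_deriv i \<psi> x * flux P i \<psi> x)" for i
    using partial_deriv_mult[OF smooth_F' smooth_flux[OF assms(3)] assms(5)]
      partial_deriv_holomorphic_comp[OF assms(1) F' assms(3,5) in_W[OF assms(5)]]
    by simp
  finally show ?thesis
    unfolding div_op_def grad_prod_def
    by (simp add: sum.distrib sum_distrib_left scaleR_right_distrib)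
qed

text \<open>The formula on which both parts of the theorem rest. One application of \<open>L\<close> to \<open>F \<circ> \<psi>\<close> gives
  \<open>F'(\<psi>) \<tau> + F''(\<psi>) q\<close>; each summand is a product of a composition of the same kind with \<open>\<tau>\<close> or \<open>q\<close>, so the
  product rule and the chain rule give the second application. What matters is that \<open>F', \<dots>, F''''\<close>
  can be prescribed freely at a point, so that the four coefficients can be read off separately.\<close>
lemma div_op_div_op_holomorphic_comp:
  assumes W: "open W" "F holomorphic_on W" and \<psi>: "smooth_on S \<psi>" "\<psi> ` S \<subseteq> W" and x: "x \<in> S"
  defines "\<tau> \<equiv> div_op s P \<psi>" and "q \<equiv> grad_prod s P \<psi> \<psi>"
  shows "div_op s P (div_op s P (\<lambda>x. F (\<psi> x))) x
    = deriv F (\<psi> x) * div_op s P \<tau> x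
      + (deriv ^^ 2) F (\<psi> x) * ((\<tau> x)\<^sup>2 + 2 * grad_prod s P \<psi> \<tau> x + div_op s P q x)
      + (deriv ^^ 3) F (\<psi> x) * (2 * q x * \<tau> x + 2 * grad_prod s P \<psi> q x)
      + (deriv ^^ 4) F (\<psi> x) * (q x)\<^sup>2"
proof -
  have in_W: "\<psi> y \<in> W" if "y \<in> S" for y using that \<psi>(2) by blast
  define F1 F2 where "F1 = deriv F" and "F2 = deriv F1"
  have hol: "F1 holomorphic_on W" "F2 holomorphic_on W"
    using W unfolding F1_def F2_def by (auto intro!: holomorphic_deriv)
  have sm: "smooth_on S (\<lambda>x. F1 (\<psi> x))" "smooth_on S (\<lambda>x. F2 (\<psi> x))" "smooth_on S \<tau>" "smooth_on S q"
    using smooth_on_holomorphic_comp[OF open_S W(1) hol(1) \<psi>(1) in_W]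
      smooth_on_holomorphic_comp[OF open_S W(1) hol(2) \<psi>(1) in_W]
    unfolding \<tau>_def q_def by (auto intro: smooth_div_op smooth_grad_prod \<psi>(1))
  have "div_op s P (div_op s P (\<lambda>x. F (\<psi> x))) x
      = div_op s P (\<lambda>y. F1 (\<psi> y) * \<tau> y + F2 (\<psi> y) * q y) x"
    by (rule div_op_cong[OF open_S x])
      (simp add: div_op_holomorphic_comp[OF W \<psi>] \<tau>_def q_def F1_def F2_def)
  also have "\<dots> = div_op s P (\<lambda>y. F1 (\<psi> y) * \<tau> y) x + div_op s P (\<lambda>y. F2 (\<psi> y) * q y) x"
    by (intro div_op_add smooth_on_mult sm open_S x)
  also have "div_op s P (\<lambda>y. F1 (\<psi> y) * \<tau> y) x = F1 (\<psi> x) * div_op s P \<tau> x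
      + \<tau> x * (F2 (\<psi> x) * \<tau> x + deriv F2 (\<psi> x) * q x) + 2 * (F2 (\<psi> x) * grad_prod s P \<psi> \<tau> x)"
    using div_op_mult[OF sm(1,3) x] div_op_holomorphic_comp[OF W(1) hol(1) \<psi> x]
      grad_prod_holomorphic_comp[OF W(1) hol(1) \<psi>(1) x in_W[OF x]]
    by (simp add: \<tau>_def q_def F2_def)
  also have "div_op s P (\<lambda>y. F2 (\<psi> y) * q y) x = F2 (\<psi> x) * div_op s P q x
      + q x * (deriv F2 (\<psi> x) * \<tau> x + deriv (deriv F2) (\<psi> x) * q x)
      + 2 * (deriv F2 (\<psi> x) * grad_prod s P \<psi> q x)"
    using div_op_mult[OF sm(2,4) x] div_op_holomorphic_comp[OF W(1) hol(2) \<psi> x]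
      grad_prod_holomorphic_comp[OF W(1) hol(2) \<psi>(1) x in_W[OF x]]
    by (simp add: \<tau>_def q_def F2_def)
  finally show ?thesis
    by (simp add: F1_def F2_def numeral_2_eq_2 numeral_3_eq_3 numeral_eq_Suc algebra_simps)
qed

end

lemma partial_deriv_zero: "partial_deriv i (\<lambda>x. 0) x = 0"
  by (simp add: partial_deriv_def)

context divergence_form
begin

lemma div_op_zero: "\<lbrakk>\<And>y. y \<in> S \<Longrightarrow> u y = 0; x \<in> S\<rbrakk> \<Longrightarrow> div_op s P u x = 0"
  by (subst div_op_cong[OF open_S, of x u "\<lambda>_. 0"])
    (auto simp: div_op_def flux_def[abs_def] partial_deriv_zero)

lemma grad_prod_zero: "\<lbrakk>\<And>y. y \<in> S \<Longrightarrow> v y = 0; x \<in> S\<rbrakk> \<Longrightarrow> grad_prod s P u v x = 0"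
  by (subst grad_prod_cong[OF open_S, of x u u v "\<lambda>_. 0"])
    (auto simp: grad_prod_def flux_def[abs_def] partial_deriv_zero)

text \<open>Where \<open>q\<close> vanishes identically, so do \<open>L q\<close> and \<open>\<Gamma>(\<psi>, q)\<close>, and only two of the four coefficients
  survive.\<close>
lemma div_op_div_op_conformal:
  assumes W: "open W" "F holomorphic_on W" and \<psi>: "smooth_on S \<psi>" "\<psi> ` S \<subseteq> W" and x: "x \<in> S"
    and q: "\<And>y. y \<in> S \<Longrightarrow> grad_prod s P \<psi> \<psi> y = 0"
  shows "div_op s P (div_op s P (\<lambda>x. F (\<psi> x))) x
    = deriv F (\<psi> x) * div_op s P (div_op s P \<psi>) x
      + (deriv ^^ 2) F (\<psi> x) * ((div_op s P \<psi> x)\<^sup>2 + 2 * grad_prod s P \<psi> (div_op s P \<psi>) x)"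
  unfolding div_op_div_op_holomorphic_comp[OF W \<psi> x]
  using q[OF x] div_op_zero[OF q x] grad_prod_zero[where u = \<psi>, OF q x] by simp

lemma div_op_div_op_bounded_linear:
  assumes L: "bounded_linear L" and "smooth_on S u" "x \<in> S"
  shows "div_op s P (div_op s P (\<lambda>x. L (u x))) x = L (div_op s P (div_op s P u) x)"
proof -
  have "div_op s P (div_op s P (\<lambda>x. L (u x))) x = div_op s P (\<lambda>y. L (div_op s P u y)) x"
    by (rule div_op_cong[OF open_S assms(3) div_op_bounded_linear[OF assms(1,2)]])
  also have "\<dots> = L (div_op s P (div_op s P u) x)"
    by (rule div_op_bounded_linear[OF L smooth_div_op[OF assms(2)] assms(3)])
  finally show ?thesis .
qed

text \<open>The real parts of \<open>F \<circ> \<psi>\<close> and of \<open>\<i> F \<circ> \<psi>\<close> together determine \<open>F \<circ> \<psi>\<close>.\<close>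
lemma biharmonic_entire_comp:
  assumes \<psi>: "smooth_on S \<psi>"
    and test: "\<forall>F. F holomorphic_on UNIV \<longrightarrow> (\<forall>x\<in>S. div_op s P (div_op s P (\<lambda>x. Re (F (\<psi> x)))) x = 0)"
    and F: "F holomorphic_on UNIV" and x: "x \<in> S"
  shows "div_op s P (div_op s P (\<lambda>x. F (\<psi> x))) x = 0"
proof -
  have sm: "smooth_on S (\<lambda>x. F (\<psi> x))" if "F holomorphic_on UNIV" for F
    using smooth_on_holomorphic_comp[OF open_S open_UNIV that \<psi>] by simp
  have Re0: "Re (div_op s P (div_op s P (\<lambda>x. F (\<psi> x))) x) = 0" if "F holomorphic_on UNIV" for F
    using div_op_div_op_bounded_linear[OF bounded_linear_Re sm[OF that] x] test that x by simp
  have iF: "(\<lambda>z. \<i> * F z) holomorphic_on UNIV" by (intro holomorphic_intros F)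
  have "div_op s P (div_op s P (\<lambda>x. \<i> * F (\<psi> x))) x = \<i> * div_op s P (div_op s P (\<lambda>x. F (\<psi> x))) x"
    by (rule div_op_div_op_bounded_linear[OF bounded_linear_mult_right sm[OF F] x])
  then show ?thesis using Re0[OF iF] Re0[OF F] by (simp add: complex_eq_iff)
qed

text \<open>The test functions are powers centred at the value of \<open>\<psi>\<close> at the point in question: for
  \<open>F(w) = (w - \<psi> y)\<^sup>4\<close> the only derivative that does not vanish at \<open>\<psi> y\<close> is the fourth, which leaves
  \<open>24 q\<^sup>2 = 0\<close>. Once \<open>q\<close> is known to vanish everywhere, \<open>F(w) = (w - \<psi> x)\<^sup>2\<close> isolates the coefficient of \<open>F''\<close>.\<close>
lemma biharmonic_test_consequences:
  assumes \<psi>: "smooth_on S \<psi>"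
    and test: "\<forall>F. F holomorphic_on UNIV \<longrightarrow> (\<forall>x\<in>S. div_op s P (div_op s P (\<lambda>x. Re (F (\<psi> x)))) x = 0)"
    and x: "x \<in> S"
  shows "grad_prod s P \<psi> \<psi> x = 0"
    and "(div_op s P \<psi> x)\<^sup>2 + 2 * grad_prod s P \<psi> (div_op s P \<psi>) x = 0"
proof -
  have deriv_power: "deriv (\<lambda>w::complex. (w - c) ^ n) w = of_nat n * (w - c) ^ (n - 1)" for c n w
    using higher_deriv_power[of 1 c n w] by simp
  have q: "grad_prod s P \<psi> \<psi> y = 0" if "y \<in> S" for y
  proof -
    let ?F = "\<lambda>w. (w - \<psi> y) ^ 4"
    have "?F holomorphic_on UNIV" by (intro holomorphic_intros)
    from div_op_div_op_holomorphic_comp[OF open_UNIV this \<psi> subset_UNIV that] biharmonic_entire_comp[OF \<psi> test this that]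
    show ?thesis
      by (simp add: higher_deriv_power deriv_power flip: pochhammer_fact)
  qed
  show "grad_prod s P \<psi> \<psi> x = 0" by (rule q[OF x])
  let ?F = "\<lambda>w. (w - \<psi> x) ^ 2"
  have "?F holomorphic_on UNIV" by (intro holomorphic_intros)
  from div_op_div_op_conformal[OF open_UNIV this \<psi> subset_UNIV x q] biharmonic_entire_comp[OF \<psi> test this x]
  have "2 * ((div_op s P \<psi> x)\<^sup>2 + 2 * grad_prod s P \<psi> (div_op s P \<psi>) x) = 0"
    by (simp add: higher_deriv_power deriv_power flip: pochhammer_fact)
  then show "(div_op s P \<psi> x)\<^sup>2 + 2 * grad_prod s P \<psi> (div_op s P \<psi>) x = 0"
    by (simp only: mult_eq_0_iff) simp
qed

end

section \<open>Weakly conformal functions on plane domains\<close>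

text \<open>A nonzero null vector of a complexified definite quadratic form in two variables spans one of two
  complex lines, on which the form acts as \<open>\<plusminus>\<i>\<close> times a rotation by a right angle (normalising the
  determinant to 1). Completing the square gives \<open>(a \<xi>\<^sub>1 + b \<xi>\<^sub>2)\<^sup>2 + \<xi>\<^sub>2\<^sup>2 = 0\<close>.\<close>
lemma isotropic_planar_covector:
  fixes a b c :: real and \<xi>1 \<xi>2 :: complex
  assumes det: "a * c - b\<^sup>2 = 1" and null: "a * \<xi>1\<^sup>2 + 2 * b * \<xi>1 * \<xi>2 + c * \<xi>2\<^sup>2 = 0"
  obtains \<kappa> where "\<kappa> \<in> {\<i>, -\<i>}" "a * \<xi>1 + b * \<xi>2 = \<kappa> * \<xi>2" "b * \<xi>1 + c * \<xi>2 = - \<kappa> * \<xi>1"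
proof -
  define X where "X = a * \<xi>1 + b * \<xi>2"
  have ac: "a * c = 1 + b\<^sup>2" using det by simp
  then have "a * c > 0" by (simp add: add_pos_nonneg)
  then have a: "complex_of_real a \<noteq> 0" by auto
  have det': "complex_of_real a * c = 1 + b\<^sup>2"
    unfolding of_real_mult[symmetric] ac by simp
  have "(X - \<i> * \<xi>2) * (X + \<i> * \<xi>2) = X\<^sup>2 + \<xi>2\<^sup>2"
    by (simp add: algebra_simps power2_eq_square)
  also have "\<dots> = a * (a * \<xi>1\<^sup>2 + 2 * b * \<xi>1 * \<xi>2) + (1 + b\<^sup>2) * \<xi>2\<^sup>2"
    by (simp add: X_def algebra_simps power2_eq_square)
  also have "\<dots> = a * (a * \<xi>1\<^sup>2 + 2 * b * \<xi>1 * \<xi>2 + c * \<xi>2\<^sup>2)"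
    unfolding det'[symmetric] by (simp add: algebra_simps)
  finally have "X = \<i> * \<xi>2 \<or> X = -\<i> * \<xi>2"
    using null by (simp add: eq_neg_iff_add_eq_0)
  then obtain \<kappa> where \<kappa>: "\<kappa> \<in> {\<i>, -\<i>}" "X = \<kappa> * \<xi>2" by blast
  then have \<kappa>2: "\<kappa> * \<kappa> = -1" by auto
  have "a * (b * \<xi>1 + c * \<xi>2) = b * (X - b * \<xi>2) + (1 + b\<^sup>2) * \<xi>2"
    unfolding det'[symmetric] by (simp add: X_def algebra_simps)
  also have "\<dots> = b * (\<kappa> * \<xi>2) - (\<kappa> * \<kappa>) * \<xi>2"
    by (simp add: \<kappa> \<kappa>2 algebra_simps power2_eq_square)
  also have "\<dots> = - \<kappa> * (X - b * \<xi>2)" by (simp add: \<kappa> algebra_simps)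
  also have "\<dots> = a * (- \<kappa> * \<xi>1)" by (simp add: X_def)
  finally have "b * \<xi>1 + c * \<xi>2 = - \<kappa> * \<xi>1" using a mult_left_cancel by blast
  then show thesis using that[OF \<kappa>(1)] \<kappa>(2) unfolding X_def by simp
qed

text \<open>In dimension two a weakly conformal \<open>\<psi>\<close> is harmonic wherever \<open>d\<psi> \<noteq> 0\<close>: there the flux of \<open>\<psi>\<close> is
  \<open>\<plusminus>\<i>\<close> times \<open>d\<psi>\<close> rotated by a right angle, the sign is locally constant, and a rotated gradient is
  divergence-free because mixed partial derivatives commute. At the zeros of \<open>d\<psi>\<close> the relation
  \<open>\<tau>\<^sup>2 + 2 \<Gamma>(\<psi>, \<tau>) = 0\<close> reduces to \<open>\<tau>\<^sup>2 = 0\<close>, which settles these points one by one.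
  The two elements \<open>a\<close> and \<open>b\<close> of the index type are its only ones. The hypothesis \<open>det\<close> holds for
  the Laplace--Beltrami operator because \<open>|g|\<^sup>1\<^sup>/\<^sup>2 g\<^sup>-\<^sup>1\<close> has determinant 1 exactly in dimension two.\<close>
lemma (in divergence_form) planar_conformal_div_op_eq_0:
  fixes a b :: 'n
  assumes idx: "a \<noteq> b" "UNIV = {a, b}"
    and det: "\<And>y. y \<in> S \<Longrightarrow> P a a y * P b b y - (P a b y)\<^sup>2 = 1"
    and s: "\<And>y. y \<in> S \<Longrightarrow> s y \<noteq> 0"
    and \<psi>: "smooth_on S \<psi>"
    and q: "\<And>y. y \<in> S \<Longrightarrow> grad_prod s P \<psi> \<psi> y = 0"
    and x: "x \<in> S" and eq: "(div_op s P \<psi> x)\<^sup>2 + 2 * grad_prod s P \<psi> (div_op s P \<psi>) x = 0"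
  shows "div_op s P \<psi> x = 0"
proof -
  let ?p = "\<lambda>i. partial_deriv i \<psi>"
  have two: "(\<Sum>i\<in>UNIV. g i) = g a + g b" for g :: "'n \<Rightarrow> complex"
    unfolding idx(2) using idx(1) by simp
  have fl: "flux P i \<psi> y = P i a y * ?p a y + P i b y * ?p b y" for i y
    by (simp add: flux_def two scaleR_conv_of_real)
  have null: "P a a y * (?p a y)\<^sup>2 + 2 * P a b y * ?p a y * ?p b y + P b b y * (?p b y)\<^sup>2 = 0"
    if "y \<in> S" for y
    using q[OF that] s[OF that] P_sym[OF that, of a b]
    by (simp add: grad_prod_def two fl) (simp add: algebra_simps power2_eq_square)
  have sign: "\<exists>\<kappa>\<in>{\<i>, -\<i>}. flux P a \<psi> y = \<kappa> * ?p b y \<and> flux P b \<psi> y = - \<kappa> * ?p a y"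
    if "y \<in> S" for y
    by (rule isotropic_planar_covector[OF det[OF that] null[OF that]])
      (auto simp: fl P_sym[OF that, of b a])
  show ?thesis
  proof (cases "?p b x = 0")
    case True
    have "P a a x * P b b x = 1 + (P a b x)\<^sup>2" using det[OF x] by simp
    then have "P a a x * P b b x > 0" by (simp add: add_pos_nonneg)
    then have "P a a x \<noteq> 0" by auto
    then have "?p a x = 0" using null[OF x] True by simp
    with True have "grad_prod s P \<psi> v x = 0" for v
      by (simp add: grad_prod_def two)
    with eq show ?thesis by simp
  next
    case False
    from sign[OF x] obtain \<kappa> where \<kappa>: "\<kappa> \<in> {\<i>, -\<i>}" "flux P a \<psi> x = \<kappa> * ?p b x" by blast
    have \<kappa>_nz: "\<kappa> \<noteq> 0" using \<kappa>(1) by auto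
    \<comment> \<open>Excluding the opposite sign is an open condition, and on \<open>T\<close> it forces the sign \<open>\<kappa>\<close> found at \<open>x\<close>.\<close>
    define T where "T = {y \<in> S. flux P a \<psi> y + \<kappa> * ?p b y \<noteq> 0}"
    have "continuous_on S (\<lambda>y. flux P a \<psi> y + \<kappa> * ?p b y)"
      by (intro continuous_intros smooth_on_imp_continuous_on smooth_flux smooth_on_partial_deriv \<psi>)
    from continuous_open_preimage[OF this open_S, of "- {0}"]
    moreover have "T = S \<inter> (\<lambda>y. flux P a \<psi> y + \<kappa> * ?p b y) -` (- {0})"
      by (auto simp: T_def)
    ultimately have T: "open T" by (simp add: open_Compl)
    have xT: "x \<in> T" using x False \<kappa>_nz by (simp add: T_def \<kappa>(2))
    have T': "flux P a \<psi> y = \<kappa> * ?p b y" "flux P b \<psi> y = (- \<kappa>) * ?p a y" if "y \<in> T" for y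
      using sign[of y] that \<kappa>(1) by (auto simp: T_def)
    have "partial_deriv a (flux P a \<psi>) x = partial_deriv a (\<lambda>y. \<kappa> * ?p b y) x"
      by (rule partial_deriv_cong[OF T xT T'(1)])
    also have "\<dots> = \<kappa> * partial_deriv a (?p b) x"
      by (rule partial_deriv_bounded_linear[OF bounded_linear_mult_right smooth_on_partial_deriv[OF \<psi>] x])
    finally have 1: "partial_deriv a (flux P a \<psi>) x = \<kappa> * partial_deriv a (?p b) x" .
    have "partial_deriv b (flux P b \<psi>) x = partial_deriv b (\<lambda>y. (- \<kappa>) * ?p a y) x"
      by (rule partial_deriv_cong[OF T xT T'(2)])
    also have "\<dots> = (- \<kappa>) * partial_deriv b (?p a) x"
      by (rule partial_deriv_bounded_linear[OF bounded_linear_mult_right smooth_on_partial_deriv[OF \<psi>] x])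
    finally show ?thesis
      using 1 partial_deriv_commute[OF open_S \<psi> x, of a b] by (simp add: div_op_def two)
  qed
qed

section \<open>Harmonic functions in the plane\<close>

text \<open>The chart of the complex plane, and its inverse. A map into \<open>real^2\<close> is studied through its
  composition with \<open>complex_of_vec\<close>, so that both parts of the theorem concern complex-valued maps.\<close>
definition vec_of_complex :: "complex \<Rightarrow> real^2" where
  "vec_of_complex z = vector [Re z, Im z]"

definition complex_of_vec :: "real^2 \<Rightarrow> complex" where
  "complex_of_vec y = Complex (y $ 1) (y $ 2)"

lemma vec_of_complex_of_vec [simp]: "vec_of_complex (complex_of_vec y) = y"
  by (simp add: vec_of_complex_def complex_of_vec_def vec_eq_iff forall_2)

lemma complex_of_vec_of_complex [simp]: "complex_of_vec (vec_of_complex z) = z"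
  by (simp add: vec_of_complex_def complex_of_vec_def)

lemma vec_of_complex_eq: "vec_of_complex z = Re z *\<^sub>R axis 1 1 + Im z *\<^sub>R axis 2 1"
  by (simp add: vec_of_complex_def vec_eq_iff forall_2 axis_def)

lemma bounded_linear_vec_of_complex: "bounded_linear vec_of_complex"
  unfolding vec_of_complex_eq[abs_def]
  by (intro bounded_linear_add bounded_linear_compose[OF bounded_linear_scaleR_left]
      bounded_linear_Re bounded_linear_Im)

lemma bounded_linear_complex_of_vec: "bounded_linear complex_of_vec"
proof (rule linear_conv_bounded_linear[THEN iffD1], rule linearI)
qed (auto simp: complex_of_vec_def complex_eq_iff)

text \<open>Take \<open>F = f\<^sub>x - \<i> f\<^sub>y\<close>: the Cauchy--Riemann equations for \<open>F\<close> are \<open>\<Delta>f = 0\<close> and the equality of the mixed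
  derivatives of \<open>f\<close>.\<close>
lemma harmonic_complex_gradient:
  fixes f :: "real^2 \<Rightarrow> real"
  assumes "open V" "smooth_on V f"
    and harm: "\<And>y. y \<in> V \<Longrightarrow> partial_deriv 1 (partial_deriv 1 f) y + partial_deriv 2 (partial_deriv 2 f) y = 0"
  obtains F where "F holomorphic_on (vec_of_complex -` V)"
    and "\<And>z. vec_of_complex z \<in> V \<Longrightarrow>
      ((\<lambda>z. f (vec_of_complex z)) has_derivative (\<lambda>v. Re (F z * v))) (at z)"
proof -
  define F where "F = (\<lambda>z. Complex (partial_deriv 1 f (vec_of_complex z)) (- partial_deriv 2 f (vec_of_complex z)))"
  have D: "((\<lambda>z. g (vec_of_complex z)) has_derivative
      (\<lambda>v. Re v * partial_deriv 1 g (vec_of_complex z) + Im v * partial_deriv 2 g (vec_of_complex z))) (at z)"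
    if "smooth_on V g" "vec_of_complex z \<in> V" for g :: "real^2 \<Rightarrow> real" and z
  proof -
    have g: "(g has_derivative frechet_derivative g (at (vec_of_complex z))) (at (vec_of_complex z))"
      using smooth_on_has_derivative[OF that] .
    have "frechet_derivative g (at p) (vec_of_complex v)
        = Re v * frechet_derivative g (at p) (axis 1 1) + Im v * frechet_derivative g (at p) (axis 2 1)"
      if "p = vec_of_complex z" for p v
      using g that
      by (simp add: vec_of_complex_eq[of v] linear_add[OF has_derivative_linear]
          linear_cmul[OF has_derivative_linear])
    then show ?thesis
      using has_derivative_compose[OF bounded_linear_imp_has_derivative[OF bounded_linear_vec_of_complex] g]
      by (simp add: partial_deriv_def)
  qed
  have df: "((\<lambda>z. f (vec_of_complex z)) has_derivative (\<lambda>v. Re (F z * v))) (at z)"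
    if "vec_of_complex z \<in> V" for z
    using D[OF assms(2) that] by (simp add: F_def mult.commute)
  have "F field_differentiable (at z)" if z: "vec_of_complex z \<in> V" for z
  proof -
    let ?d = "\<lambda>i j. partial_deriv i (partial_deriv j f) (vec_of_complex z)"
    have comm: "?d 1 2 = ?d 2 1"
      unfolding partial_deriv_def[abs_def]
      using frechet_derivative_commute_real[OF assms(1,2) z] by blast
    have "(F has_derivative (\<lambda>v. Complex (Re v * ?d 1 1 + Im v * ?d 2 1) (- (Re v * ?d 1 2 + Im v * ?d 2 2)))) (at z)"
      unfolding F_def Complex_eq
      using D[OF smooth_on_partial_deriv[OF assms(2)] z]
      by (auto intro!: derivative_eq_intros simp: fun_eq_iff algebra_simps)
    moreover have d22: "?d 2 2 = - ?d 1 1" using harm[OF z] by simp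
    have "(\<lambda>v. Complex (Re v * ?d 1 1 + Im v * ?d 2 1) (- (Re v * ?d 1 2 + Im v * ?d 2 2)))
        = (*) (Complex (?d 1 1) (- ?d 1 2))"
      unfolding d22 comm by (simp add: fun_eq_iff complex_eq_iff algebra_simps)
    ultimately show ?thesis
      unfolding field_differentiable_def has_field_derivative_def by auto
  qed
  then have "F holomorphic_on (vec_of_complex -` V)"
    by (auto simp: holomorphic_on_def field_differentiable_at_within)
  then show thesis using that df by blast
qed

text \<open>On a disc the holomorphic gradient has a primitive \<open>H\<close>, and \<open>f - Re H\<close> has derivative zero there, so
  \<open>f\<close> is \<open>Re H\<close> up to a real constant, which is added to \<open>H\<close>.\<close>
lemma harmonic_locally_Re_holomorphic:
  fixes f :: "real^2 \<Rightarrow> real"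
  assumes "open V" "smooth_on V f"
    and harm: "\<And>y. y \<in> V \<Longrightarrow> partial_deriv 1 (partial_deriv 1 f) y + partial_deriv 2 (partial_deriv 2 f) y = 0"
    and z0: "vec_of_complex z0 \<in> V"
  obtains H W where "open W" "z0 \<in> W" "H holomorphic_on W"
    "\<forall>z\<in>W. f (vec_of_complex z) = Re (H z)"
proof -
  let ?W = "vec_of_complex -` V"
  have "open ?W"
    by (intro open_vimage assms(1) linear_continuous_on bounded_linear_vec_of_complex)
  then obtain r where r: "r > 0" "ball z0 r \<subseteq> ?W"
    using z0 openE[of ?W z0] by auto
  obtain F where F: "F holomorphic_on ?W" "\<And>z. vec_of_complex z \<in> V \<Longrightarrow>
      ((\<lambda>z. f (vec_of_complex z)) has_derivative (\<lambda>v. Re (F z * v))) (at z)"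
    using harmonic_complex_gradient[OF assms(1-3)] by blast
  obtain H where H: "\<And>z. z \<in> ball z0 r \<Longrightarrow> (H has_field_derivative F z) (at z within ball z0 r)"
    using holomorphic_convex_primitive'[OF convex_ball open_ball holomorphic_on_subset[OF F(1) r(2)]]
    by blast
  have H': "(H has_field_derivative F z) (at z)" if "z \<in> ball z0 r" for z
    using H[OF that] that by (simp add: at_within_open[OF that])
  have "\<exists>c. \<forall>z\<in>ball z0 r. f (vec_of_complex z) - Re (H z) = c"
  proof (rule has_derivative_zero_constant[OF convex_ball])
    fix z assume z: "z \<in> ball z0 r"
    have "((\<lambda>z. Re (H z)) has_derivative (\<lambda>v. Re (F z * v))) (at z)"
      using H'[OF z] by (auto intro!: derivative_eq_intros simp: has_field_derivative_def)
    moreover have "vec_of_complex z \<in> V" using r(2) z by auto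
    ultimately have "((\<lambda>z. f (vec_of_complex z) - Re (H z)) has_derivative (\<lambda>v. Re (F z * v) - Re (F z * v))) (at z)"
      by (intro has_derivative_diff F(2))
    then show "((\<lambda>z. f (vec_of_complex z) - Re (H z)) has_derivative (\<lambda>h. 0)) (at z within ball z0 r)"
      by (simp add: has_derivative_at_withinI)
  qed
  then obtain c where c: "\<And>z. z \<in> ball z0 r \<Longrightarrow> f (vec_of_complex z) - Re (H z) = c"
    by blast
  show thesis
  proof (rule that[of "ball z0 r" "\<lambda>z. H z + of_real c"])
    show "(\<lambda>z. H z + of_real c) holomorphic_on ball z0 r"
      using H by (intro holomorphic_intros) (unfold holomorphic_on_def field_differentiable_def, blast)
  qed (use r(1) c in \<open>auto simp: algebra_simps\<close>)
qed

section \<open>Compositions with harmonic functions\<close>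

text \<open>Harmonicity on a plane open set without reference to charts; harmonicity on each of the two target
  manifolds \<open>euclidean_domain UNIV\<close> and \<open>complex_plane\<close> translates into it.\<close>
definition plane_harmonic_on :: "(real^2) set \<Rightarrow> (real^2 \<Rightarrow> real) \<Rightarrow> bool" where
  "plane_harmonic_on V f \<longleftrightarrow> smooth_on V f \<and>
     (\<forall>y\<in>V. partial_deriv 1 (partial_deriv 1 f) y + partial_deriv 2 (partial_deriv 2 f) y = 0)"

context divergence_form
begin

text \<open>Because the operator is local, this reduces every statement about \<open>f \<circ> \<psi>\<close> for harmonic \<open>f\<close> to the
  formulas for \<open>F \<circ> \<psi>\<close> with holomorphic \<open>F\<close>.\<close>
lemma harmonic_comp_local:
  assumes \<psi>: "smooth_on S \<psi>" and V: "open V" "plane_harmonic_on V f"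
    and x: "x \<in> S" "vec_of_complex (\<psi> x) \<in> V"
  obtains T W H where "open T" "x \<in> T" "T \<subseteq> S" "open W" "H holomorphic_on W" "\<psi> ` T \<subseteq> W"
    "\<forall>y\<in>T. f (vec_of_complex (\<psi> y)) = Re (H (\<psi> y))"
proof -
  from V(2) have f: "smooth_on V f" "\<And>y. y \<in> V \<Longrightarrow>
      partial_deriv 1 (partial_deriv 1 f) y + partial_deriv 2 (partial_deriv 2 f) y = 0"
    by (auto simp: plane_harmonic_on_def)
  obtain H W where H: "open W" "\<psi> x \<in> W" "H holomorphic_on W"
    "\<forall>z\<in>W. f (vec_of_complex z) = Re (H z)"
    by (rule harmonic_locally_Re_holomorphic[OF V(1) f x(2)])
  show thesis
    by (rule that[of "S \<inter> \<psi> -` W" W H])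
      (use H x continuous_open_preimage[OF smooth_on_imp_continuous_on[OF \<psi>] open_S H(1)] in auto)
qed

text \<open>Locally the composition is \<open>Re (H \<circ> \<psi>)\<close> with \<open>H\<close> holomorphic, and a composition with a
  holomorphic function is smooth by the chain rule for \<open>deriv\<close>.\<close>
lemma smooth_on_harmonic_comp:
  assumes \<psi>: "smooth_on S \<psi>" and V: "open V" "plane_harmonic_on V f"
    and A: "A \<subseteq> S" "\<And>x. x \<in> A \<Longrightarrow> vec_of_complex (\<psi> x) \<in> V"
  shows "smooth_on A (\<lambda>x. f (vec_of_complex (\<psi> x)))"
proof (rule smooth_on_local)
  fix x assume x: "x \<in> A"
  obtain T W H where T: "open T" "x \<in> T" "T \<subseteq> S" "open W" "H holomorphic_on W" "\<psi> ` T \<subseteq> W"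
    and eq: "\<forall>y\<in>T. f (vec_of_complex (\<psi> y)) = Re (H (\<psi> y))"
    using harmonic_comp_local[OF \<psi> V _ A(2)[OF x]] A(1) x by blast
  have "smooth_on T (\<lambda>y. H (\<psi> y))"
    using T by (intro smooth_on_holomorphic_comp[OF T(1,4,5)] smooth_on_subset[OF \<psi>]) auto
  from smooth_on_bounded_linear_comp[OF bounded_linear_Re T(1) this]
  have "smooth_on T (\<lambda>x. f (vec_of_complex (\<psi> x)))"
    by (rule smooth_on_cong[OF T(1)]) (simp add: eq)
  with T show "\<exists>T. open T \<and> x \<in> T \<and> smooth_on T (\<lambda>x. f (vec_of_complex (\<psi> x)))" by blast
qed

lemma div_op_harmonic_comp:
  assumes \<psi>: "smooth_on S \<psi>" and V: "open V" "plane_harmonic_on V f"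
    and x: "x \<in> S" "vec_of_complex (\<psi> x) \<in> V"
    and \<tau>: "div_op s P \<psi> x = 0" and q: "grad_prod s P \<psi> \<psi> x = 0"
  shows "div_op s P (\<lambda>x. f (vec_of_complex (\<psi> x))) x = 0"
proof -
  obtain T W H where T: "open T" "x \<in> T" "T \<subseteq> S" "open W" "H holomorphic_on W" "\<psi> ` T \<subseteq> W"
    and eq: "\<forall>y\<in>T. f (vec_of_complex (\<psi> y)) = Re (H (\<psi> y))"
    by (rule harmonic_comp_local[OF \<psi> V x])
  interpret T: divergence_form T s P using restrict T by blast
  have \<psi>T: "smooth_on T \<psi>" using \<psi> T(3) by (rule smooth_on_subset)
  have "smooth_on T (\<lambda>y. H (\<psi> y))"
    using T by (intro smooth_on_holomorphic_comp[OF T(1,4,5) \<psi>T]) auto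
  then show ?thesis
    using div_op_cong[OF T(1,2) bspec[OF eq], where s = s and P = P]
    by (simp add: T.div_op_bounded_linear[OF bounded_linear_Re _ T(2)]
        T.div_op_holomorphic_comp[OF T(4,5) \<psi>T T(6,2)] \<tau> q)
qed

lemma div_op_div_op_harmonic_comp:
  assumes \<psi>: "smooth_on S \<psi>" and V: "open V" "plane_harmonic_on V f"
    and x: "x \<in> S" "vec_of_complex (\<psi> x) \<in> V"
    and q: "\<And>y. y \<in> S \<Longrightarrow> grad_prod s P \<psi> \<psi> y = 0"
    and bi: "div_op s P (div_op s P \<psi>) x = 0"
    and eq: "(div_op s P \<psi> x)\<^sup>2 + 2 * grad_prod s P \<psi> (div_op s P \<psi>) x = 0"
  shows "div_op s P (div_op s P (\<lambda>x. f (vec_of_complex (\<psi> x)))) x = 0"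
proof -
  obtain T W H where T: "open T" "x \<in> T" "T \<subseteq> S" "open W" "H holomorphic_on W" "\<psi> ` T \<subseteq> W"
    and fH: "\<forall>y\<in>T. f (vec_of_complex (\<psi> y)) = Re (H (\<psi> y))"
    by (rule harmonic_comp_local[OF \<psi> V x])
  interpret T: divergence_form T s P using restrict T by blast
  have \<psi>T: "smooth_on T \<psi>" using \<psi> T(3) by (rule smooth_on_subset)
  have H\<psi>: "smooth_on T (\<lambda>y. H (\<psi> y))"
    using T by (intro smooth_on_holomorphic_comp[OF T(1,4,5) \<psi>T]) auto
  have "div_op s P (div_op s P (\<lambda>x. f (vec_of_complex (\<psi> x)))) x
      = div_op s P (div_op s P (\<lambda>x. Re (H (\<psi> x)))) x"
    by (rule div_op_cong[OF T(1,2) div_op_cong[OF T(1) _ bspec[OF fH]]])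
  also have "\<dots> = Re (div_op s P (div_op s P (\<lambda>x. H (\<psi> x))) x)"
    by (rule T.div_op_div_op_bounded_linear[OF bounded_linear_Re H\<psi> T(2)])
  also have "div_op s P (div_op s P (\<lambda>x. H (\<psi> x))) x = 0"
    using T.div_op_div_op_conformal[OF T(4,5) \<psi>T T(6,2)] q T(3) bi eq by auto
  finally show ?thesis by simp
qed

end

section \<open>The coordinate Laplacian\<close>

lemma laplacian_coord_eq_div_op:
  "laplacian_coord G u x
    = div_op (\<lambda>x. 1 / sqrt (det (G x))) (\<lambda>i j y. sqrt (det (G y)) * matrix_inv (G y) $ i $ j) u x"
  by (simp add: laplacian_coord_def div_op_def flux_def[abs_def])

lemma laplacian_coord_cong:
  "\<lbrakk>open T; x \<in> T; \<And>y. y \<in> T \<Longrightarrow> u y = v y\<rbrakk> \<Longrightarrow> laplacian_coord G u x = laplacian_coord G v x"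
  unfolding laplacian_coord_eq_div_op by (rule div_op_cong)

lemma matrix_inv_eqI:
  fixes A B :: "real^'n::finite^'n"
  assumes "A ** B = mat 1" "B ** A = mat 1"
  shows "matrix_inv A = B"
  unfolding matrix_inv_def
proof (rule some_equality)
  fix C assume C: "A ** C = mat 1 \<and> C ** A = mat 1"
  have "C = C ** (A ** B)" using assms by simp
  also have "\<dots> = B" using C by (simp add: matrix_mul_assoc)
  finally show "C = B" .
qed (use assms in simp)

definition kronecker :: "'n \<Rightarrow> 'n \<Rightarrow> real^'n::finite \<Rightarrow> real" where
  "kronecker i j x = (if i = j then 1 else 0)"

lemma flat_coefficients: "divergence_form S (\<lambda>_. 1) kronecker" if "open S"
  by unfold_locales (use that in \<open>auto simp: kronecker_def[abs_def] intro!: smooth_on_const\<close>)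

lemma laplacian_coord_flat:
  "laplacian_coord (\<lambda>_::real^'n::finite. mat 1) = div_op (\<lambda>_. 1) kronecker"
proof -
  have "matrix_inv (mat 1 :: real^'n^'n) = mat 1" by (rule matrix_inv_eqI) simp_all
  moreover have "kronecker = (\<lambda>i j y. (mat 1 :: real^'n^'n) $ i $ j)"
    by (simp add: fun_eq_iff kronecker_def mat_def)
  ultimately show ?thesis
    by (intro ext) (simp add: laplacian_coord_eq_div_op)
qed

lemma flux_kronecker: "flux kronecker i u = partial_deriv i u"
proof
  fix x
  have "kronecker i j x *\<^sub>R partial_deriv j u x = (if j = i then partial_deriv j u x else 0)" for j
    by (simp add: kronecker_def)
  then show "flux kronecker i u x = partial_deriv i u x"
    by (simp add: flux_def)
qed

lemma div_op_flat: "div_op (\<lambda>_. 1) kronecker u x = (\<Sum>i\<in>UNIV. partial_deriv i (partial_deriv i u) x)"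
  by (simp add: div_op_def flux_kronecker)

lemma grad_prod_flat:
  "grad_prod (\<lambda>_. 1) kronecker u v x = (\<Sum>i\<in>UNIV. partial_deriv i u x * partial_deriv i v x)"
  by (simp add: grad_prod_def flux_kronecker)

lemma plane_harmonic_on_iff:
  "plane_harmonic_on V f \<longleftrightarrow> smooth_on V f \<and> (\<forall>y\<in>V. laplacian_coord (\<lambda>_. mat 1) f y = 0)"
  unfolding plane_harmonic_on_def laplacian_coord_flat div_op_flat sum_2 ..

lemma plane_harmonic_on_Re_entire:
  assumes F: "F holomorphic_on UNIV"
  shows "plane_harmonic_on UNIV (\<lambda>y. Re (F (complex_of_vec y)))"
proof -
  interpret divergence_form UNIV "\<lambda>_::real^2. 1::real" kronecker by (rule flat_coefficients) simp
  have sm: "smooth_on UNIV complex_of_vec"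
    by (intro smooth_on_bounded_linear bounded_linear_complex_of_vec open_UNIV)
  have smF: "smooth_on UNIV (\<lambda>y. F (complex_of_vec y))"
    by (rule smooth_on_holomorphic_comp[OF open_UNIV open_UNIV F sm]) simp
  have p: "partial_deriv i complex_of_vec = (\<lambda>_. complex_of_vec (axis i 1))" for i
    by (intro ext partial_deriv_eq bounded_linear_imp_has_derivative bounded_linear_complex_of_vec)
  have "partial_deriv i (partial_deriv i complex_of_vec) y = 0" for i y
    by (simp add: p) (simp add: partial_deriv_def)
  then have \<tau>: "div_op (\<lambda>_. 1) kronecker complex_of_vec y = 0" for y
    by (simp add: div_op_flat)
  have q: "grad_prod (\<lambda>_. 1) kronecker complex_of_vec complex_of_vec y = 0" for y
    by (simp add: grad_prod_flat p sum_2 complex_of_vec_def axis_def complex_eq_iff)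
  have "div_op (\<lambda>_. 1) kronecker (\<lambda>y. Re (F (complex_of_vec y))) y = 0" for y
    using div_op_bounded_linear[OF bounded_linear_Re smF, of y]
      div_op_holomorphic_comp[OF open_UNIV F sm subset_UNIV, of y] \<tau> q by simp
  then show ?thesis
    unfolding plane_harmonic_on_iff laplacian_coord_flat
    using smooth_on_bounded_linear_comp[OF bounded_linear_Re open_UNIV smF] by simp
qed

section \<open>Harmonicity in charts\<close>

lemma chart_map_inv: "x \<in> chart_map c ` chart_dom c \<Longrightarrow> chart_map c (chart_inv c x) = x"
  unfolding chart_inv_def by (rule f_inv_into_f)

lemma chart_inv_in_dom: "x \<in> chart_map c ` chart_dom c \<Longrightarrow> chart_inv c x \<in> chart_dom c"
  unfolding chart_inv_def by (rule inv_into_into)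

lemma harmonic_on_iff_coord:
  "harmonic_on M A u \<longleftrightarrow> smooth_fun_on M A u \<and>
     (\<forall>c\<in>atlas M. \<forall>x\<in>chart_map c ` (chart_dom c \<inter> A). laplacian_coord (gram M c) (u \<circ> chart_inv c) x = 0)"
  unfolding harmonic_on_def laplace_beltrami_def by auto

lemma biharmonic_on_iff_coord:
  assumes "\<And>c. c \<in> atlas M \<Longrightarrow> open (chart_map c ` chart_dom c)"
  shows "biharmonic_on M A u \<longleftrightarrow> smooth_fun_on M A u \<and>
     (\<forall>c\<in>atlas M. \<forall>x\<in>chart_map c ` (chart_dom c \<inter> A).
        laplacian_coord (gram M c) (laplacian_coord (gram M c) (u \<circ> chart_inv c)) x = 0)"
proof -
  have "laplace_beltrami M c (laplace_beltrami M c u) p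
      = laplacian_coord (gram M c) (laplacian_coord (gram M c) (u \<circ> chart_inv c)) (chart_map c p)"
    if "c \<in> atlas M" "p \<in> chart_dom c \<inter> A" for c p
    unfolding laplace_beltrami_def
    by (rule laplacian_coord_cong[OF assms[OF that(1)]])
      (use that in \<open>auto simp: laplace_beltrami_def chart_map_inv\<close>)
  then show ?thesis unfolding biharmonic_on_def by auto
qed

lemma flat_manifold_sel [simp]:
  "atlas (flat_manifold U e) = {(U, e)}" "mtop (flat_manifold U e) = top_of_set U"
  "gram (flat_manifold U e) = (\<lambda>_ _. mat 1)"
  by (simp_all add: flat_manifold_def)

lemma chart_inv_ident: "y \<in> U \<Longrightarrow> chart_inv (U, \<lambda>x. x) y = y"
  unfolding chart_inv_def by (simp add: f_inv_into_f[of y "\<lambda>x. x" U, simplified])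

lemma complex_plane_eq: "complex_plane = flat_manifold UNIV vec_of_complex"
  by (simp add: complex_plane_def vec_of_complex_def[abs_def])

lemma chart_inv_complex: "chart_inv (UNIV, vec_of_complex) = complex_of_vec"
proof
  fix y :: "real^2"
  have "inj vec_of_complex" by (metis complex_of_vec_of_complex injI)
  then have "inv_into UNIV vec_of_complex (vec_of_complex (complex_of_vec y)) = complex_of_vec y"
    by (rule inv_into_f_f) simp
  then show "chart_inv (UNIV, vec_of_complex) y = complex_of_vec y"
    by (simp add: chart_inv_def)
qed

lemma harmonic_on_euclidean_plane:
  "harmonic_on (euclidean_domain UNIV) V f \<longleftrightarrow> plane_harmonic_on V f"
proof -
  have "f \<circ> chart_inv (UNIV, \<lambda>x. x) = f" by (simp add: fun_eq_iff chart_inv_ident)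
  then show ?thesis
    by (simp add: harmonic_on_iff_coord plane_harmonic_on_iff smooth_fun_on_def euclidean_domain_def)
qed

lemma harmonic_on_complex_plane:
  "harmonic_on complex_plane W f \<longleftrightarrow> plane_harmonic_on (vec_of_complex ` W) (f \<circ> complex_of_vec)"
  by (simp add: harmonic_on_iff_coord plane_harmonic_on_iff smooth_fun_on_def complex_plane_eq
      chart_inv_complex)

section \<open>Surfaces\<close>

text \<open>The adjugate of a 2 by 2 matrix; in this form it is visibly linear in the entries, so it inherits
  smoothness from them.\<close>
definition adjugate2 :: "real^2^2 \<Rightarrow> real^2^2" where
  "adjugate2 A = (A $ 1 $ 1 + A $ 2 $ 2) *\<^sub>R mat 1 - A"

lemma matrix_inv_2:
  fixes A :: "real^2^2"
  assumes "det A \<noteq> 0"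
  shows "matrix_inv A = (1 / det A) *\<^sub>R adjugate2 A"
proof (rule matrix_inv_eqI)
  have "A ** adjugate2 A = det A *\<^sub>R mat 1" "adjugate2 A ** A = det A *\<^sub>R mat 1"
    by (simp_all add: vec_eq_iff forall_2 matrix_matrix_mult_def sum_2 adjugate2_def mat_def det_2
        algebra_simps)
  moreover have "A ** (k *\<^sub>R B) = k *\<^sub>R (A ** B)" "(k *\<^sub>R B) ** A = k *\<^sub>R (B ** A)" for k and B :: "real^2^2"
    by (simp_all add: vec_eq_iff matrix_matrix_mult_def sum_2 algebra_simps)
  ultimately show "A ** ((1 / det A) *\<^sub>R adjugate2 A) = mat 1" "((1 / det A) *\<^sub>R adjugate2 A) ** A = mat 1"
    using assms by simp_all
qed

lemma det_pos_2:
  fixes A :: "real^2^2"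
  assumes "transpose A = A" and pos: "\<And>v. v \<noteq> 0 \<Longrightarrow> v \<bullet> (A *v v) > 0"
  shows "det A > 0"
proof -
  define a b c where "a = A $ 1 $ 1" and "b = A $ 1 $ 2" and "c = A $ 2 $ 2"
  have "A $ 2 $ 1 = transpose A $ 1 $ 2" by (simp add: transpose_def)
  then have b: "A $ 2 $ 1 = b" by (simp add: assms(1) b_def)
  have form: "v \<bullet> (A *v v) = a * (v $ 1)\<^sup>2 + 2 * b * v $ 1 * v $ 2 + c * (v $ 2)\<^sup>2" for v
    by (simp add: inner_vec_def matrix_vector_mult_def sum_2 b flip: a_def b_def c_def)
      (simp add: algebra_simps power2_eq_square)
  have a: "a > 0"
    using pos[of "vector [1, 0]"] unfolding form by (auto simp: vec_eq_iff forall_2)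
  have "(vector [- b, a] :: real^2) \<noteq> 0" using a by (auto simp: vec_eq_iff forall_2)
  from pos[OF this] have "a * (a * c - b * b) > 0"
    unfolding form by (simp add: algebra_simps power2_eq_square)
  then show ?thesis
    using a by (simp add: zero_less_mult_iff det_2 b flip: a_def b_def c_def)
qed

text \<open>In dimension two \<open>|g|\<^sup>1\<^sup>/\<^sup>2 g\<^sup>-\<^sup>1\<close> is the adjugate of \<open>g\<close> divided by \<open>|g|\<^sup>1\<^sup>/\<^sup>2\<close>; its determinant is 1, since the
  adjugate has the same determinant as \<open>g\<close>.\<close>
lemma planar_metric_coefficients:
  fixes G :: "real^2 \<Rightarrow> real^2^2"
  assumes S: "open S" and G: "smooth_on S G"
    and spd: "\<forall>x\<in>S. transpose (G x) = G x \<and> (\<forall>v. v \<noteq> 0 \<longrightarrow> v \<bullet> (G x *v v) > 0)"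
  defines "P \<equiv> \<lambda>i j y. sqrt (det (G y)) * matrix_inv (G y) $ i $ j"
  shows "divergence_form S (\<lambda>x. 1 / sqrt (det (G x))) P"
    and "\<And>x. x \<in> S \<Longrightarrow> P 1 1 x * P 2 2 x - (P 1 2 x)\<^sup>2 = 1"
    and "\<And>x. x \<in> S \<Longrightarrow> 1 / sqrt (det (G x)) \<noteq> 0"
proof -
  have sym: "transpose (G x) = G x" if "x \<in> S" for x using spd that by blast
  have det: "det (G x) > 0" if "x \<in> S" for x using det_pos_2[of "G x"] spd that by blast
  have entry: "smooth_on S (\<lambda>x. G x $ i $ j)" for i j
    by (intro smooth_on_bounded_linear_comp[OF _ S G] bounded_linear_compose[OF bounded_linear_vec_nth]
        bounded_linear_vec_nth)
  have "smooth_on S (\<lambda>x. det (G x))"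
    unfolding det_2 by (intro smooth_on_diff smooth_on_mult entry S)
  then have root: "smooth_on S (\<lambda>x. 1 / sqrt (det (G x)))"
    by (rule smooth_on_inverse_sqrt[OF S]) (rule det)
  have P: "P i j x = 1 / sqrt (det (G x)) * adjugate2 (G x) $ i $ j" if "x \<in> S" for i j x
    using det[OF that] real_sqrt_pow2[of "det (G x)"]
    by (simp add: P_def matrix_inv_2 field_simps power2_eq_square)
  have "smooth_on S (\<lambda>x. adjugate2 (G x) $ i $ j)" for i j
  proof -
    have "smooth_on S (\<lambda>x. (G x $ 1 $ 1 + G x $ 2 $ 2) * (mat 1 :: real^2^2) $ i $ j - G x $ i $ j)"
      by (intro smooth_on_diff smooth_on_mult smooth_on_add smooth_on_const entry S)
    then show ?thesis by (simp add: adjugate2_def)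
  qed
  then have smP: "smooth_on S (P i j)" for i j
    by (intro smooth_on_cong[OF S smooth_on_mult[OF S root] P[symmetric]])
  have "G x $ i $ j = G x $ j $ i" if "x \<in> S" for i j x
  proof -
    have "G x $ j $ i = transpose (G x) $ i $ j" by (simp add: transpose_def)
    then show ?thesis by (simp add: sym[OF that])
  qed
  then have adj_sym: "adjugate2 (G x) $ i $ j = adjugate2 (G x) $ j $ i" if "x \<in> S" for i j x
    using that by (simp add: adjugate2_def mat_def)
  show "divergence_form S (\<lambda>x. 1 / sqrt (det (G x))) P"
    by unfold_locales (use S root smP P adj_sym in auto)
  show "1 / sqrt (det (G x)) \<noteq> 0" if "x \<in> S" for x using det[OF that] by simp
  show "P 1 1 x * P 2 2 x - (P 1 2 x)\<^sup>2 = 1" if "x \<in> S" for x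
  proof -
    have "P 1 1 x * P 2 2 x - (P 1 2 x)\<^sup>2
        = (adjugate2 (G x) $ 1 $ 1 * adjugate2 (G x) $ 2 $ 2 - (adjugate2 (G x) $ 1 $ 2)\<^sup>2) / (sqrt (det (G x)))\<^sup>2"
      by (simp add: P[OF that] power2_eq_square diff_divide_distrib)
    also have "\<dots> = det (G x) / det (G x)"
      using det[OF that] adj_sym[OF that, of 1 2]
      by (simp add: det_2 adjugate2_def mat_def power2_eq_square)
    finally show ?thesis using det[OF that] by simp
  qed
qed

text \<open>In each chart the test functions give \<open>q = 0\<close> and the relation that forces \<open>\<tau> = 0\<close> on a surface; then
  \<open>L (f \<circ> \<phi>) = Re (F'(\<psi>) \<tau> + F''(\<psi>) q) = 0\<close> for every harmonic \<open>f\<close>, written locally as \<open>Re F\<close>.\<close>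
theorem generalized_harmonic_morphism_surface_imp_harmonic_morphism:
  fixes M :: "('m, 2) riemannian_data" and \<phi> :: "'m \<Rightarrow> real^2"
  assumes M: "riemannian_manifold M"
    and ghm: "generalized_harmonic_morphism M (euclidean_domain UNIV) \<phi>"
  shows "harmonic_morphism M (euclidean_domain UNIV) \<phi>"
proof -
  let ?N = "euclidean_domain (UNIV :: (real^2) set)"
  have N: "mtop ?N = euclidean" "atlas ?N = {(UNIV, \<lambda>x. x)}" by (simp_all add: euclidean_domain_def)
  have smooth: "smooth_map M ?N \<phi>" and bih: "\<And>V f. \<lbrakk>open V; mpreimage M \<phi> V \<noteq> {}; plane_harmonic_on V f\<rbrakk>
      \<Longrightarrow> biharmonic_on M (mpreimage M \<phi> V) (f \<circ> \<phi>)"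
    using ghm by (auto simp: generalized_harmonic_morphism_def N harmonic_on_euclidean_plane)
  have chart: "open (chart_map c ` chart_dom c)" "chart_dom c \<subseteq> topspace (mtop M)"
    "inj_on (chart_map c) (chart_dom c)" if "c \<in> atlas M" for c
  proof -
    have c: "openin (mtop M) (chart_dom c)" "open (chart_map c ` chart_dom c)"
      "homeomorphic_map (subtopology (mtop M) (chart_dom c))
          (top_of_set (chart_map c ` chart_dom c)) (chart_map c)"
      using M that by (auto simp: riemannian_manifold_def smooth_structure_def)
    show "open (chart_map c ` chart_dom c)" by fact
    show *: "chart_dom c \<subseteq> topspace (mtop M)" using c(1) by (rule openin_subset)
    show "inj_on (chart_map c) (chart_dom c)"
      using homeomorphic_imp_injective_map[OF c(3)] * by (simp add: inf.absorb2)
  qed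
  have bih_coord: "laplacian_coord (gram M c) (laplacian_coord (gram M c) (u \<circ> chart_inv c)) x = 0"
    if "biharmonic_on M A u" "c \<in> atlas M" "x \<in> chart_map c ` (chart_dom c \<inter> A)"
    for A c x and u :: "'m \<Rightarrow> real"
    using biharmonic_on_iff_coord[of M A u] chart(1) that by blast
  have "harmonic_on M (mpreimage M \<phi> V) (f \<circ> \<phi>)"
    if V: "open V" "mpreimage M \<phi> V \<noteq> {}" "plane_harmonic_on V f" for V f
    unfolding harmonic_on_iff_coord
  proof (intro conjI ballI)
    show "smooth_fun_on M (mpreimage M \<phi> V) (f \<circ> \<phi>)"
      using bih[OF V] by (simp add: biharmonic_on_def)
    fix c x assume c: "c \<in> atlas M" and x: "x \<in> chart_map c ` (chart_dom c \<inter> mpreimage M \<phi> V)"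
    define S where "S = chart_map c ` chart_dom c"
    define \<psi> where "\<psi> = (\<lambda>y. complex_of_vec (\<phi> (chart_inv c y)))"
    \<comment> \<open>The coefficients of the Laplace--Beltrami operator in the chart \<open>c\<close>.\<close>
    define s where "s = (\<lambda>x. 1 / sqrt (det (gram M c x)))"
    define P where "P = (\<lambda>i j y. sqrt (det (gram M c y)) * matrix_inv (gram M c y) $ i $ j)"
    have S: "open S" using chart(1)[OF c] by (simp add: S_def)
    have G: "smooth_on S (gram M c)" "\<forall>x\<in>S. transpose (gram M c x) = gram M c x \<and>
        (\<forall>v. v \<noteq> 0 \<longrightarrow> v \<bullet> (gram M c x *v v) > 0)"
      using M c by (auto simp: riemannian_manifold_def riemannian_metric_def S_def)
    have coeff: "divergence_form S s P" "\<And>x. x \<in> S \<Longrightarrow> P 1 1 x * P 2 2 x - (P 1 2 x)\<^sup>2 = 1"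
      "\<And>x. x \<in> S \<Longrightarrow> s x \<noteq> 0"
      unfolding s_def P_def by (fact planar_metric_coefficients[OF S G])+
    interpret divergence_form S s P by (rule coeff(1))
    have L: "laplacian_coord (gram M c) u = div_op s P u" for u :: "real^2 \<Rightarrow> real"
      unfolding s_def P_def by (rule ext) (rule laplacian_coord_eq_div_op)
    have xS: "x \<in> S" using x by (auto simp: S_def)
    have in_top: "chart_inv c y \<in> topspace (mtop M)" if "y \<in> S" for y
      using chart_inv_in_dom[of y c] that chart(2)[OF c] by (auto simp: S_def)
    have "smooth_on S (\<lambda>y. \<phi> (chart_inv c y))"
      using smooth c by (simp add: smooth_map_def N map_in_charts_def S_def comp_def)
    then have \<psi>: "smooth_on S \<psi>"
      unfolding \<psi>_def by (rule smooth_on_bounded_linear_comp[OF bounded_linear_complex_of_vec S])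
    have "div_op s P (div_op s P (\<lambda>y. Re (F (\<psi> y)))) y = 0"
      if F: "F holomorphic_on UNIV" and y: "y \<in> S" for F y
    proof -
      have top: "mpreimage M \<phi> UNIV = topspace (mtop M)" by (simp add: mpreimage_def)
      have "biharmonic_on M (topspace (mtop M)) ((\<lambda>y. Re (F (complex_of_vec y))) \<circ> \<phi>)"
        using bih[OF open_UNIV _ plane_harmonic_on_Re_entire[OF F]] in_top[OF y] unfolding top by blast
      moreover have "y \<in> chart_map c ` (chart_dom c \<inter> topspace (mtop M))"
        using y chart(2)[OF c] by (auto simp: S_def)
      ultimately have "laplacian_coord (gram M c) (laplacian_coord (gram M c)
          ((\<lambda>y. Re (F (complex_of_vec y))) \<circ> \<phi> \<circ> chart_inv c)) y = 0"
        using bih_coord c by blast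
      then show ?thesis by (simp add: L \<psi>_def comp_def)
    qed
    then have test: "\<forall>F. F holomorphic_on UNIV \<longrightarrow> (\<forall>x\<in>S. div_op s P (div_op s P (\<lambda>x. Re (F (\<psi> x)))) x = 0)"
      by blast
    note tests = biharmonic_test_consequences[OF \<psi> test]
    have \<tau>: "div_op s P \<psi> x = 0"
      by (rule planar_conformal_div_op_eq_0[of 1 2, OF _ UNIV_2 coeff(2,3) \<psi> tests(1) xS tests(2)[OF xS]])
        auto
    have "vec_of_complex (\<psi> x) \<in> V"
      using x chart(3)[OF c] by (auto simp: \<psi>_def mpreimage_def chart_inv_def)
    from div_op_harmonic_comp[OF \<psi> V(1,3) xS this \<tau> tests(1)[OF xS]]
    show "laplacian_coord (gram M c) (f \<circ> \<phi> \<circ> chart_inv c) x = 0"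
      by (simp add: L \<psi>_def comp_def)
  qed
  then show ?thesis
    using smooth by (auto simp: harmonic_morphism_def N harmonic_on_euclidean_plane)
qed

section \<open>Maps from Euclidean domains to the complex plane\<close>

text \<open>The rows \<open>a\<close>, \<open>b\<close> of a linear map \<open>A\<close> to the plane span the orthogonal complement \<open>H\<close> of its kernel.
  On that span the conformality condition says that the Gram matrix \<open>K\<close> of \<open>a\<close>, \<open>b\<close> satisfies
  \<open>K\<^sup>2 = m\<^sup>2 K\<close>, so \<open>K = m\<^sup>2 I\<close> when \<open>A\<close> is surjective and \<open>K\<close> therefore invertible.\<close>
lemma weakly_conformal_pair_iff:
  fixes a b :: "real^'n::finite"
  defines "A \<equiv> \<lambda>X. vector [a \<bullet> X, b \<bullet> X] :: real^2"
  defines "H \<equiv> {X. \<forall>Z. A Z = 0 \<longrightarrow> X \<bullet> Z = 0}"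
  shows "(\<exists>m\<ge>0. (\<forall>X. A X = 0) \<or> (surj A \<and> (\<forall>X\<in>H. \<forall>Y\<in>H. A X \<bullet> A Y = m\<^sup>2 * (X \<bullet> Y))))
    \<longleftrightarrow> a \<bullet> a = b \<bullet> b \<and> a \<bullet> b = 0" (is "?L \<longleftrightarrow> ?R")
proof
  have AA: "A X \<bullet> A Y = (a \<bullet> X) * (a \<bullet> Y) + (b \<bullet> X) * (b \<bullet> Y)" for X Y
    by (simp add: A_def inner_vec_def sum_2)
  have A0: "A X = 0 \<longleftrightarrow> a \<bullet> X = 0 \<and> b \<bullet> X = 0" for X
    by (simp add: A_def vec_eq_iff forall_2)
  {
    assume ?L
    then obtain m where m: "(\<forall>X. A X = 0) \<or> (surj A \<and> (\<forall>X\<in>H. \<forall>Y\<in>H. A X \<bullet> A Y = m\<^sup>2 * (X \<bullet> Y)))"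
      by blast
    show ?R
    proof (cases "\<forall>X. A X = 0")
      case True
      then have "a \<bullet> a = 0" "b \<bullet> b = 0" unfolding A0 by blast+
      then show ?thesis by simp
    next
      case False
      with m have surj: "surj A" and conf: "\<And>X Y. X \<in> H \<Longrightarrow> Y \<in> H \<Longrightarrow> A X \<bullet> A Y = m\<^sup>2 * (X \<bullet> Y)"
        by blast+
      have "a \<in> H" "b \<in> H" by (auto simp: H_def A0)
      note 1 = conf[OF \<open>a \<in> H\<close> \<open>a \<in> H\<close>, unfolded AA] and 2 = conf[OF \<open>b \<in> H\<close> \<open>b \<in> H\<close>, unfolded AA]
        and 3 = conf[OF \<open>a \<in> H\<close> \<open>b \<in> H\<close>, unfolded AA]
      obtain X where "A X = vector [1, 0]" using surjD[OF surj, of "vector [1, 0]"] by auto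
      then have X: "a \<bullet> X = 1" "b \<bullet> X = 0" by (auto simp: A_def vec_eq_iff forall_2)
      obtain Y where "A Y = vector [0, 1]" using surjD[OF surj, of "vector [0, 1]"] by auto
      then have Y: "a \<bullet> Y = 0" "b \<bullet> Y = 1" by (auto simp: A_def vec_eq_iff forall_2)
      have pos: "a \<bullet> a > 0" "b \<bullet> b > 0" using X Y by auto
      have ab: "a \<bullet> b = 0"
      proof (rule ccontr)
        assume nz: "a \<bullet> b \<noteq> 0"
        \<comment> \<open>Cancelling \<open>a \<bullet> b\<close> determines \<open>m\<^sup>2\<close>, and equality in Cauchy--Schwarz makes \<open>a\<close>, \<open>b\<close> dependent, against surjectivity.\<close>
        have "(a \<bullet> b) * (a \<bullet> a + b \<bullet> b) = (a \<bullet> b) * m\<^sup>2" using 3 by (simp add: algebra_simps inner_commute)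
        with nz have "m\<^sup>2 = a \<bullet> a + b \<bullet> b" by simp
        with 1 have "(a \<bullet> b) * (a \<bullet> b) = (a \<bullet> a) * (b \<bullet> b)" by (simp add: algebra_simps inner_commute)
        then have "((b \<bullet> b) *\<^sub>R a - (a \<bullet> b) *\<^sub>R b) \<bullet> ((b \<bullet> b) *\<^sub>R a - (a \<bullet> b) *\<^sub>R b) = 0"
          by (simp add: inner_diff_left inner_diff_right inner_commute algebra_simps)
        then have "(b \<bullet> b) *\<^sub>R a = (a \<bullet> b) *\<^sub>R b" by simp
        from arg_cong[OF this, of "\<lambda>v. v \<bullet> X"]
        have "(b \<bullet> b) * (a \<bullet> X) = (a \<bullet> b) * (b \<bullet> X)" by simp
        then show False using X pos by simp
      qed
      have "a \<bullet> a = m\<^sup>2" "b \<bullet> b = m\<^sup>2" using 1 2 pos by (auto simp: ab inner_commute[of b a])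
      with ab show ?thesis by simp
    qed
  }
  assume R: ?R
  show ?L
  proof (cases "a = 0")
    case True
    with R have "b = 0" by simp
    with True show ?thesis by (intro exI[of _ 0]) (simp add: A0)
  next
    case False
    define k where "k = a \<bullet> a"
    have k: "k > 0" "a \<bullet> a = k" "b \<bullet> b = k" "a \<bullet> b = 0" "b \<bullet> a = 0"
      using False R by (auto simp: k_def inner_commute)
    have "A ((v $ 1 / k) *\<^sub>R a + (v $ 2 / k) *\<^sub>R b) = v" for v
      using k by (simp add: A_def vec_eq_iff forall_2 inner_add_right)
    then have "surj A" by (rule surjI)
    moreover have "A X \<bullet> A Y = (sqrt k)\<^sup>2 * (X \<bullet> Y)" if X: "X \<in> H" for X Y
    proof -
      \<comment> \<open>The component of \<open>X\<close> orthogonal to \<open>a\<close> and \<open>b\<close>; it lies in the kernel, to which \<open>X\<close> is orthogonal.\<close>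
      define Z where "Z = X - ((a \<bullet> X / k) *\<^sub>R a + (b \<bullet> X / k) *\<^sub>R b)"
      have "a \<bullet> Z = 0" "b \<bullet> Z = 0"
        using k by (simp_all add: Z_def inner_diff_right inner_add_right)
      moreover from this have "X \<bullet> Z = 0" using X by (simp add: H_def A0)
      ultimately have "Z \<bullet> Z = 0"
        by (subst (1) Z_def) (simp add: inner_diff_left inner_add_left)
      then have "X = (a \<bullet> X / k) *\<^sub>R a + (b \<bullet> X / k) *\<^sub>R b" by (simp add: Z_def)
      from arg_cong[OF this, of "\<lambda>v. v \<bullet> Y"]
      have "X \<bullet> Y = (a \<bullet> X / k) * (a \<bullet> Y) + (b \<bullet> X / k) * (b \<bullet> Y)"
        by (simp only: inner_add_left inner_scaleR_left)
      then show ?thesis using k by (simp add: AA field_simps)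
    qed
    ultimately show ?thesis using k by (intro exI[of _ "sqrt k"]) auto
  qed
qed

lemma linear_eq_inner_gradient:
  fixes D :: "real^'n::finite \<Rightarrow> complex"
  assumes "linear D"
  shows "vec_of_complex (D X)
    = vector [(\<chi> i. Re (D (axis i 1))) \<bullet> X, (\<chi> i. Im (D (axis i 1))) \<bullet> X]"
proof -
  have "D X = D (\<Sum>i\<in>UNIV. X $ i *\<^sub>R axis i 1)"
    using basis_expansion[of X] by (simp add: scalar_mult_eq_scaleR)
  also have "\<dots> = (\<Sum>i\<in>UNIV. X $ i *\<^sub>R D (axis i 1))"
    by (simp add: linear_sum[OF assms] linear_cmul[OF assms])
  finally show ?thesis
    by (simp add: vec_of_complex_def inner_vec_def mult.commute)
qed

text \<open>The real and imaginary parts of \<open>\<Sum>\<^sub>i (\<partial>\<^sub>i \<psi>)\<^sup>2\<close> are \<open>|\<nabla> Re \<psi>|\<^sup>2 - |\<nabla> Im \<psi>|\<^sup>2\<close> and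
  \<open>2 \<nabla> Re \<psi> \<bullet> \<nabla> Im \<psi>\<close>.\<close>
lemma horizontally_weakly_conformal_iff_null_gradient:
  fixes \<psi> :: "real^'n::finite \<Rightarrow> complex"
  assumes U: "open U" and \<psi>: "smooth_on U \<psi>"
  shows "horizontally_weakly_conformal (euclidean_domain U) complex_plane \<psi> \<longleftrightarrow>
    smooth_map (euclidean_domain U) complex_plane \<psi> \<and>
    (\<forall>x\<in>U. (\<Sum>i\<in>UNIV. (partial_deriv i \<psi> x)\<^sup>2) = 0)"
proof -
  define a where "a x = (\<chi> i. Re (partial_deriv i \<psi> x))" for x
  define b where "b x = (\<chi> i. Im (partial_deriv i \<psi> x))" for x
  let ?c = "(U, \<lambda>x. x)" and ?d = "(UNIV, vec_of_complex)"
  have diff: "differential_in_charts ?c ?d \<psi> x = (\<lambda>X. vector [a x \<bullet> X, b x \<bullet> X])" if x: "x \<in> U" for x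
  proof -
    have D: "(\<psi> has_derivative frechet_derivative \<psi> (at x)) (at x)"
      using smooth_on_has_derivative[OF \<psi> x] .
    have "((\<lambda>y. vec_of_complex (\<psi> y)) has_derivative (\<lambda>X. vec_of_complex (frechet_derivative \<psi> (at x) X))) (at x)"
      by (rule bounded_linear.has_derivative[OF bounded_linear_vec_of_complex D])
    then have "(map_in_charts ?c ?d \<psi> has_derivative (\<lambda>X. vec_of_complex (frechet_derivative \<psi> (at x) X))) (at x)"
      by (rule has_derivative_transform_within_open[OF _ U x]) (simp add: map_in_charts_def chart_inv_ident)
    from frechet_derivative_at[OF this]
    have "differential_in_charts ?c ?d \<psi> x = (\<lambda>X. vec_of_complex (frechet_derivative \<psi> (at x) X))"
      by (simp add: differential_in_charts_def)
    then show ?thesis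
      by (simp add: linear_eq_inner_gradient[OF has_derivative_linear[OF D]] a_def b_def partial_deriv_def)
  qed
  have null: "(\<Sum>i\<in>UNIV. (partial_deriv i \<psi> x)\<^sup>2) = 0 \<longleftrightarrow> a x \<bullet> a x = b x \<bullet> b x \<and> a x \<bullet> b x = 0" for x
  proof -
    have "(\<Sum>i\<in>UNIV. (partial_deriv i \<psi> x)\<^sup>2) = Complex (a x \<bullet> a x - b x \<bullet> b x) (2 * (a x \<bullet> b x))"
      by (simp add: complex_eq_iff a_def b_def inner_vec_def power2_eq_square sum_subtractf sum_distrib_left
          mult.commute)
    then show ?thesis by (simp add: complex_eq_iff)
  qed
  define Q where "Q x m \<longleftrightarrow> m \<ge> 0 \<and> (let A = (\<lambda>X. vector [a x \<bullet> X, b x \<bullet> X] :: real^2);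
        H = {X. \<forall>Z. A Z = 0 \<longrightarrow> X \<bullet> Z = 0} in
      (\<forall>X. A X = 0) \<or> (surj A \<and> (\<forall>X\<in>H. \<forall>Y\<in>H. A X \<bullet> A Y = m\<^sup>2 * (X \<bullet> Y))))" for x and m :: real
  have Q: "(\<exists>m. Q x m) \<longleftrightarrow> a x \<bullet> a x = b x \<bullet> b x \<and> a x \<bullet> b x = 0" for x
    unfolding Q_def Let_def by (rule weakly_conformal_pair_iff)
  have "horizontally_weakly_conformal (euclidean_domain U) complex_plane \<psi> \<longleftrightarrow>
    smooth_map (euclidean_domain U) complex_plane \<psi> \<and> (\<exists>dil. \<forall>x\<in>U. Q x (dil x))"
    unfolding horizontally_weakly_conformal_def Q_def
    by (simp add: euclidean_domain_def complex_plane_eq metric_at_def diff Let_def ball_conj_distrib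
        cong: ball_cong)
  also have "(\<exists>dil. \<forall>x\<in>U. Q x (dil x)) \<longleftrightarrow> (\<forall>x\<in>U. \<exists>m. Q x m)"
    by (rule bchoice_iff[symmetric])
  also have "\<dots> \<longleftrightarrow> (\<forall>x\<in>U. a x \<bullet> a x = b x \<bullet> b x \<and> a x \<bullet> b x = 0)"
    unfolding Q ..
  finally show ?thesis unfolding null .
qed

lemma smooth_map_complex_plane_imp_smooth_on:
  assumes U: "open U" and \<psi>: "smooth_map (euclidean_domain U) complex_plane \<psi>"
  shows "smooth_on U \<psi>"
proof -
  have "smooth_on U (map_in_charts (U, \<lambda>x. x) (UNIV, vec_of_complex) \<psi>)"
    using \<psi> by (simp add: smooth_map_def euclidean_domain_def complex_plane_eq)
  from smooth_on_bounded_linear_comp[OF bounded_linear_complex_of_vec U this]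
  show ?thesis
    by (rule smooth_on_cong[OF U]) (simp add: map_in_charts_def chart_inv_ident)
qed

text \<open>The chart inverse is the identity on \<open>U\<close> only, so it disappears by locality rather than by rewriting.\<close>
lemma biharmonic_on_euclidean_domain:
  assumes U: "open U" and A: "open A" "A \<subseteq> U"
  shows "biharmonic_on (euclidean_domain U) A u \<longleftrightarrow> smooth_on A u \<and>
    (\<forall>x\<in>A. div_op (\<lambda>_. 1) kronecker (div_op (\<lambda>_. 1) kronecker u) x = 0)"
proof -
  have UA: "U \<inter> A = A" using A(2) by blast
  have "smooth_on A (u \<circ> chart_inv (U, \<lambda>x. x)) \<longleftrightarrow> smooth_on A u"
    using smooth_on_cong[OF A(1), of "u \<circ> chart_inv (U, \<lambda>x. x)" u]
      smooth_on_cong[OF A(1), of u "u \<circ> chart_inv (U, \<lambda>x. x)"] A(2)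
    by (auto simp: chart_inv_ident subset_iff)
  moreover have "div_op (\<lambda>_. 1) kronecker (div_op (\<lambda>_. 1) kronecker (u \<circ> chart_inv (U, \<lambda>x. x))) x
      = div_op (\<lambda>_. 1) kronecker (div_op (\<lambda>_. 1) kronecker u) x" if "x \<in> A" for x
    using that A(2)
    by (intro div_op_cong[OF U _ div_op_cong[OF U]]) (auto simp: chart_inv_ident)
  ultimately show ?thesis
    using biharmonic_on_iff_coord[of "euclidean_domain U" A u] U
    by (simp add: euclidean_domain_def smooth_fun_on_def UA laplacian_coord_flat)
qed

text \<open>Given \<open>q = 0\<close>, the map is a generalized harmonic morphism exactly when both coefficients \<open>L \<tau>\<close> and
  \<open>\<tau>\<^sup>2 + 2 \<Gamma>(\<psi>, \<tau>)\<close> vanish, and these are what \<open>F(w) = w\<close> and \<open>F(w) = w\<^sup>2\<close> detect.\<close>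
theorem generalized_harmonic_morphism_into_complex_plane_iff:
  fixes \<psi> :: "real^'n::finite \<Rightarrow> complex"
  assumes U: "open U" and map: "smooth_map (euclidean_domain U) complex_plane \<psi>"
  shows "generalized_harmonic_morphism (euclidean_domain U) complex_plane \<psi> \<longleftrightarrow>
    horizontally_weakly_conformal (euclidean_domain U) complex_plane \<psi> \<and>
    biharmonic_on (euclidean_domain U) U \<psi> \<and>
    biharmonic_on (euclidean_domain U) U (\<lambda>x. (\<psi> x)\<^sup>2)"
proof -
  note \<psi> = smooth_map_complex_plane_imp_smooth_on[OF U map]
  interpret divergence_form U "\<lambda>_. 1" kronecker by (rule flat_coefficients[OF U])
  let ?L = "div_op (\<lambda>_. 1) kronecker :: (real^'n \<Rightarrow> complex) \<Rightarrow> _"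
  let ?\<Gamma> = "grad_prod (\<lambda>_. 1) kronecker"
  have pre: "mpreimage (euclidean_domain U) \<psi> W = U \<inter> \<psi> -` W" for W
    by (auto simp: mpreimage_def euclidean_domain_def)
  have hwc: "horizontally_weakly_conformal (euclidean_domain U) complex_plane \<psi> \<longleftrightarrow> (\<forall>x\<in>U. ?\<Gamma> \<psi> \<psi> x = 0)"
    using horizontally_weakly_conformal_iff_null_gradient[OF U \<psi>] map
    by (simp add: grad_prod_flat power2_eq_square)
  have sq: "(\<lambda>z::complex. z\<^sup>2) holomorphic_on UNIV" "(\<lambda>z::complex. z) holomorphic_on UNIV"
    by (intro holomorphic_intros)+
  have sm_sq: "smooth_on U (\<lambda>x. (\<psi> x)\<^sup>2)"
    by (rule smooth_on_holomorphic_comp[OF U open_UNIV sq(1) \<psi>]) simp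
  have bih: "biharmonic_on (euclidean_domain U) U \<psi> \<longleftrightarrow> (\<forall>x\<in>U. ?L (?L \<psi>) x = 0)"
    "biharmonic_on (euclidean_domain U) U (\<lambda>x. (\<psi> x)\<^sup>2) \<longleftrightarrow> (\<forall>x\<in>U. ?L (?L (\<lambda>x. (\<psi> x)\<^sup>2)) x = 0)"
    using \<psi> sm_sq by (simp_all add: biharmonic_on_euclidean_domain[OF U U])
  show ?thesis
  proof
    assume ghm: "generalized_harmonic_morphism (euclidean_domain U) complex_plane \<psi>"
    have "div_op (\<lambda>_. 1) kronecker (div_op (\<lambda>_. 1) kronecker (\<lambda>x. Re (F (\<psi> x)))) x = 0"
      if F: "F holomorphic_on UNIV" and x: "x \<in> U" for F x
    proof -
      have "range vec_of_complex = UNIV" by (metis surjI vec_of_complex_of_vec)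
      then have "harmonic_on complex_plane UNIV (\<lambda>z. Re (F z))"
        using plane_harmonic_on_Re_entire[OF F] by (simp add: harmonic_on_complex_plane comp_def)
      moreover have "openin (mtop complex_plane) UNIV" by (simp add: complex_plane_eq)
      ultimately have "biharmonic_on (euclidean_domain U) U ((\<lambda>z. Re (F z)) \<circ> \<psi>)"
        using ghm x unfolding generalized_harmonic_morphism_def pre by fastforce
      then show ?thesis
        using x by (simp add: biharmonic_on_euclidean_domain[OF U U] comp_def)
    qed
    then have test: "\<forall>F. F holomorphic_on UNIV \<longrightarrow>
        (\<forall>x\<in>U. div_op (\<lambda>_. 1) kronecker (div_op (\<lambda>_. 1) kronecker (\<lambda>x. Re (F (\<psi> x)))) x = 0)"
      by blast
    note entire = biharmonic_entire_comp[OF \<psi> test]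
    show "horizontally_weakly_conformal (euclidean_domain U) complex_plane \<psi> \<and>
      biharmonic_on (euclidean_domain U) U \<psi> \<and> biharmonic_on (euclidean_domain U) U (\<lambda>x. (\<psi> x)\<^sup>2)"
      unfolding hwc bih using biharmonic_test_consequences(1)[OF \<psi> test] entire[OF sq(1)] entire[OF sq(2)] by blast
  next
    assume "horizontally_weakly_conformal (euclidean_domain U) complex_plane \<psi> \<and>
      biharmonic_on (euclidean_domain U) U \<psi> \<and> biharmonic_on (euclidean_domain U) U (\<lambda>x. (\<psi> x)\<^sup>2)"
    then have q: "\<And>x. x \<in> U \<Longrightarrow> ?\<Gamma> \<psi> \<psi> x = 0" and bi: "\<And>x. x \<in> U \<Longrightarrow> ?L (?L \<psi>) x = 0"
      and bi2: "\<And>x. x \<in> U \<Longrightarrow> ?L (?L (\<lambda>x. (\<psi> x)\<^sup>2)) x = 0"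
      unfolding hwc bih by blast+
    have eq: "(?L \<psi> x)\<^sup>2 + 2 * ?\<Gamma> \<psi> (?L \<psi>) x = 0" if x: "x \<in> U" for x
    proof -
      have "(deriv ^^ 2) (\<lambda>z::complex. z\<^sup>2) w = 2" for w
        using higher_deriv_power[of 2 0 2 w] by (simp flip: pochhammer_fact)
      then have "2 * ((?L \<psi> x)\<^sup>2 + 2 * ?\<Gamma> \<psi> (?L \<psi>) x) = 0"
        using div_op_div_op_conformal[OF open_UNIV sq(1) \<psi> subset_UNIV x q] bi[OF x] bi2[OF x] by simp
      then show ?thesis by (simp only: mult_eq_0_iff) simp
    qed
    have "biharmonic_on (euclidean_domain U) (mpreimage (euclidean_domain U) \<psi> W) (f \<circ> \<psi>)"
      if W: "openin (mtop complex_plane) W" and f: "harmonic_on complex_plane W f"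
      for W and f :: "complex \<Rightarrow> real"
    proof -
      let ?V = "vec_of_complex ` W" and ?g = "f \<circ> complex_of_vec"
      have openW: "open W" using W by (simp add: complex_plane_eq)
      have "?V = complex_of_vec -` W" by (auto simp: image_iff) (metis vec_of_complex_of_vec)
      then have V: "open ?V"
        using openW by (simp add: open_vimage linear_continuous_on bounded_linear_complex_of_vec)
      have g: "plane_harmonic_on ?V ?g" using f by (simp add: harmonic_on_complex_plane)
      have A: "open (U \<inter> \<psi> -` W)"
        by (rule continuous_open_preimage[OF smooth_on_imp_continuous_on[OF \<psi>] U openW])
      have "smooth_on (U \<inter> \<psi> -` W) (f \<circ> \<psi>)"
        using smooth_on_harmonic_comp[OF \<psi> V g, of "U \<inter> \<psi> -` W"] by (simp add: comp_def)
      moreover have "div_op (\<lambda>_. 1) kronecker (div_op (\<lambda>_. 1) kronecker (f \<circ> \<psi>)) x = 0"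
        if "x \<in> U \<inter> \<psi> -` W" for x
        using that div_op_div_op_harmonic_comp[OF \<psi> V g _ _ q bi eq, of x] by (simp add: comp_def)
      ultimately show ?thesis
        unfolding pre by (simp add: biharmonic_on_euclidean_domain[OF U A])
    qed
    then show "generalized_harmonic_morphism (euclidean_domain U) complex_plane \<psi>"
      using map unfolding generalized_harmonic_morphism_def by blast
  qed
qed

theorem corollary2p5:
  fixes M :: "('m, 2) riemannian_data" and \<phi> :: "'m \<Rightarrow> real^2"
    and U :: "(real^3) set" and \<psi> :: "real^3 \<Rightarrow> complex"
  shows
    "(riemannian_manifold M \<and>
      generalized_harmonic_morphism M (euclidean_domain UNIV) \<phi> \<longrightarrow>
        harmonic_morphism M (euclidean_domain UNIV) \<phi>) \<and>
     (open U \<and> smooth_map (euclidean_domain U) complex_plane \<psi> \<longrightarrow>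
        (generalized_harmonic_morphism (euclidean_domain U) complex_plane \<psi> \<longleftrightarrow>
           horizontally_weakly_conformal (euclidean_domain U) complex_plane \<psi> \<and>
           biharmonic_on (euclidean_domain U) U \<psi> \<and>
           biharmonic_on (euclidean_domain U) U (\<lambda>x. (\<psi> x)\<^sup>2)))"
  using generalized_harmonic_morphism_surface_imp_harmonic_morphism
    generalized_harmonic_morphism_into_complex_plane_iff by blast

end
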